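(* Consider the theory $$\mathcal{L}_{\psi\mathrm{M}}(s,p,\psi)=\frac{s}{\sqrt2}\,\mathfrak{t}_++\frac{p}{\sqrt2}\,\mathfrak{t}_--\frac{\psi}{2}\,\mathfrak{t}_\psi,$$ where $$\mathfrak{t}_+=\sqrt{1-\frac{\psi p}{s^2+p^2}+\sqrt{\frac{s^2+(\psi-p)^2}{s^2+p^2}}},$$ $$\mathfrak{t}_-=\frac{1}{\psi s}\sqrt{\psi^2s^2\left[\frac{\psi p}{s^2+p^2}-1+\sqrt{\frac{s^2+(\psi-p)^2}{s^2+p^2}}\,\right]},$$ $$\mathfrak{t}_\psi=\arctan\left(\frac{s}{p}\right)+2\arctan\left(\frac{\mathfrak{t}_-}{\sqrt2+\mathfrak{t}_+}\right).$$ Then: (i) $\mathcal{L}_{\psi\mathrm{M}}$ satisfies the duality-invariance condition $$p\left(\frac{\partial\mathcal{L}}{\partial s}\right)^2-2s\,\frac{\partial\mathcal{L}}{\partial s}\frac{\partial\mathcal{L}}{\partial p}-p\left(\frac{\partial\mathcal{L}}{\partial p}\right)^2+\psi=p$$ for nonzero $\psi$, by virtue of the identities $$\frac{\partial\mathcal{L}_{\psi\mathrm{M}}}{\partial s}=\frac{\mathfrak{t}_+}{\sqrt2},\quad \frac{\partial\mathcal{L}_{\psi\mathrm{M}}}{\partial p}=\frac{\mathfrak{t}_-}{\sqrt2},\quad \frac{\partial\mathcal{L}_{\psi\mathrm{M}}}{\partial\psi}=-\frac{\mathfrak{t}_\psi}{2},$$ $$\mathfrak{t}_+^2=\mathfrak{t}_-^2+2-\frac{2\psi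 p}{s^2+p^2},\quad \mathfrak{t}_+\mathfrak{t}_-=\frac{\psi s}{s^2+p^2};$$ (ii) $\mathcal{L}_{\psi\mathrm{M}}$ satisfies the homogeneity condition $$s\frac{\partial\mathcal{L}}{\partial s}+p\frac{\partial\mathcal{L}}{\partial p}+\psi\frac{\partial\mathcal{L}}{\partial\psi}=\mathcal{L};$$ (iii) as $\psi\to0$ it reduces to Maxwell theory: $\lim_{\psi\to0}\mathcal{L}_{\psi\mathrm{M}}=s$; (iv) $\mathcal{L}_{\psi\mathrm{M}}$ is always real for all real values of $s$, $p$ and $\psi$, as seen from $$\frac{s^2+(\psi-p)^2}{s^2+p^2}=\frac{\psi^2s^2}{(s^2+p^2)^2}+\left(1-\frac{\psi p}{s^2+p^2}\right)^2;$$ (v) $\mathcal{L}_{\psi\mathrm{M}}$ is not analytic for null fields $s=p=0$; (vi) in the weak-field limit $\psi^2\gg s^2+p^2>0$, with $x=s/\psi$, $y=p/\psi$ and $\omega^{\pm}=\sqrt{x^2+y^2\pm y\sqrt{x^2+y^2}}$, $$\mathcal{L}_{\psi\mathrm{M}}=-\psi\left[\frac{\arctan\left(\frac{x}{y}\right)}{2}+\mathrm{sign}(x)\arctan\frac{\omega^+}{\omega^-}\right]+\frac{\psi\left[(y+\sqrt{x^2+y^2})\,\omega^++|x|\,\omega^-\right]}{\sqrt2\,(x^2+y^2)^{3/4}\,\mathrm{sign}(x)}+\mathcal{O}\left(x^{3/2},y^{3/2}\right),$$ so no Maxwell limit is obtained in this regime; (vii) for $\gamma\in\mathbb{R}$,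 applying the ModMax map gives an additional one-parameter family of duality-invariant theories $$\mathcal{M}_\gamma(\mathcal{L}_{\psi\mathrm{M}})=\mathcal{L}_{\psi\mathrm{M}}\big(\mathcal{L}^{\mathrm{MM}}_\gamma(s,p),p,\psi\big),$$ which satisfies $\lim_{\psi\to0}\mathcal{M}_\gamma(\mathcal{L}_{\psi\mathrm{M}})=\mathcal{L}^{\mathrm{MM}}_\gamma$.
   Context: Here $s=-\frac14F_{ab}F^{ab}$ and $p=-\frac14F_{ab}(\star F)^{ab}$ are the invariants of the electromagnetic field strength $F_{ab}$, with $(\star F)_{ab}=\frac12\varepsilon_{abcd}F^{cd}$, and $\psi$ is a term independent of $F_{ab}$. A theory $\mathcal{L}(s,p,\psi)$ is duality-invariant if it satisfies the condition displayed in (i). Maxwell theory is $\mathcal{L}=s$, and the ModMax Lagrangian is $\mathcal{L}^{\mathrm{MM}}_\gamma(s,p)=\cosh\gamma\;s+\sinh\gamma\,\sqrt{s^2+p^2}$. The ModMax map $\mathcal{M}_\gamma$ replaces every appearance of $s$ in a Lagrangian by $\mathcal{L}^{\mathrm{MM}}_\gamma(s,p)$. The notation $\mathcal{O}(x^{3/2},y^{3/2})$ denotes terms that, under a rescaling $(x,y)\to(ax,ay)$, get an overall factor $a^k$ with $k\geq3/2$. *)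

theory Defs
  imports "HOL-Analysis.Analysis" "HOL-Library.Landau_Symbols"
begin

type_synonym lagrangian = "real \<Rightarrow> real \<Rightarrow> real \<Rightarrow> real"  \<comment> \<open>arguments \<open>s\<close>, \<open>p\<close>, \<open>\<psi>\<close>\<close>


section \<open>The theory\<close>

text \<open>
  The formulas contain the factors \<open>1/(\<psi> s)\<close> and \<open>s/p\<close>, so they are literally meaningful
  exactly for \<open>s\<close>, \<open>p\<close>, \<open>\<psi>\<close> all nonzero. Outside that set HOL's convention \<open>x / 0 = 0\<close>
  applies; in particular \<open>t_minus 0 p \<psi> = 0\<close>.
\<close>

definition t_plus :: "real \<Rightarrow> real \<Rightarrow> real \<Rightarrow> real" where
  "t_plus s p \<psi> =
     sqrt (1 - \<psi> * p / (s^2 + p^2) + sqrt ((s^2 + (\<psi> - p)^2) / (s^2 + p^2)))"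

definition t_minus :: "real \<Rightarrow> real \<Rightarrow> real \<Rightarrow> real" where
  "t_minus s p \<psi> =
     1 / (\<psi> * s) *
     sqrt (\<psi>^2 * s^2 * (\<psi> * p / (s^2 + p^2) - 1 + sqrt ((s^2 + (\<psi> - p)^2) / (s^2 + p^2))))"

definition t_psi :: "real \<Rightarrow> real \<Rightarrow> real \<Rightarrow> real" where
  "t_psi s p \<psi> = arctan (s / p) + 2 * arctan (t_minus s p \<psi> / (sqrt 2 + t_plus s p \<psi>))"

definition L_psiM :: lagrangian where
  "L_psiM s p \<psi> = s / sqrt 2 * t_plus s p \<psi> + p / sqrt 2 * t_minus s p \<psi> - \<psi> / 2 * t_psi s p \<psi>"

text \<open>
  HOL's \<^const>\<open>sqrt\<close> is total on the reals (with \<open>sqrt (- x) = - sqrt x\<close>), so the reality of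
  \<^const>\<open>L_psiM\<close> has no content. It is therefore expressed by the same formulas read over the
  complex numbers, with the principal square root and arctangent.
\<close>

definition t_plus_complex :: "complex \<Rightarrow> complex \<Rightarrow> complex \<Rightarrow> complex" where
  "t_plus_complex s p \<psi> =
     csqrt (1 - \<psi> * p / (s^2 + p^2) + csqrt ((s^2 + (\<psi> - p)^2) / (s^2 + p^2)))"

definition t_minus_complex :: "complex \<Rightarrow> complex \<Rightarrow> complex \<Rightarrow> complex" where
  "t_minus_complex s p \<psi> =
     1 / (\<psi> * s) *
     csqrt (\<psi>^2 * s^2 * (\<psi> * p / (s^2 + p^2) - 1 + csqrt ((s^2 + (\<psi> - p)^2) / (s^2 + p^2))))"

definition t_psi_complex :: "complex \<Rightarrow> complex \<Rightarrow> complex \<Rightarrow> complex" where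
  "t_psi_complex s p \<psi> =
     Arctan (s / p) + 2 * Arctan (t_minus_complex s p \<psi> / (csqrt 2 + t_plus_complex s p \<psi>))"

definition L_psiM_complex :: "complex \<Rightarrow> complex \<Rightarrow> complex \<Rightarrow> complex" where
  "L_psiM_complex s p \<psi> =
     s / csqrt 2 * t_plus_complex s p \<psi> + p / csqrt 2 * t_minus_complex s p \<psi>
     - \<psi> / 2 * t_psi_complex s p \<psi>"


section \<open>Duality invariance and homogeneity\<close>

definition duality_invariant_at :: "lagrangian \<Rightarrow> real \<Rightarrow> real \<Rightarrow> real \<Rightarrow> bool" where
  "duality_invariant_at L s p \<psi> \<longleftrightarrow>
     (\<exists>Ls Lp.
        ((\<lambda>s'. L s' p \<psi>) has_real_derivative Ls) (at s) \<and>
        ((\<lambda>p'. L s p' \<psi>) has_real_derivative Lp) (at p) \<and>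
        p * Ls^2 - 2 * s * Ls * Lp - p * Lp^2 + \<psi> = p)"

definition homogeneity_condition_at :: "lagrangian \<Rightarrow> real \<Rightarrow> real \<Rightarrow> real \<Rightarrow> bool" where
  "homogeneity_condition_at L s p \<psi> \<longleftrightarrow>
     (\<exists>Ls Lp L\<psi>.
        ((\<lambda>s'. L s' p \<psi>) has_real_derivative Ls) (at s) \<and>
        ((\<lambda>p'. L s p' \<psi>) has_real_derivative Lp) (at p) \<and>
        ((\<lambda>\<psi>'. L s p \<psi>') has_real_derivative L\<psi>) (at \<psi>) \<and>
        s * Ls + p * Lp + \<psi> * L\<psi> = L s p \<psi>)"


section \<open>ModMax\<close>

definition L_MM :: "real \<Rightarrow> real \<Rightarrow> real \<Rightarrow> real" where
  "L_MM \<gamma> s p = cosh \<gamma> * s + sinh \<gamma> * sqrt (s^2 + p^2)"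

definition ModMax_map :: "real \<Rightarrow> lagrangian \<Rightarrow> lagrangian" where
  "ModMax_map \<gamma> L = (\<lambda>s p \<psi>. L (L_MM \<gamma> s p) p \<psi>)"


section \<open>Analyticity and the weak-field expansion\<close>

definition real_analytic_at :: "(real \<Rightarrow> real \<Rightarrow> real) \<Rightarrow> real \<Rightarrow> real \<Rightarrow> bool" where
  "real_analytic_at f a b \<longleftrightarrow>
     (\<exists>(c :: nat \<Rightarrow> nat \<Rightarrow> real) r. r > 0 \<and>
        (\<forall>x y. \<bar>x - a\<bar> < r \<and> \<bar>y - b\<bar> < r \<longrightarrow>
           ((\<lambda>(i, j). c i j * (x - a)^i * (y - b)^j) has_sum f x y) UNIV))"

definition off_axes :: "(real \<times> real) set" where
  "off_axes = {(x, y). x \<noteq> 0 \<and> y \<noteq> 0}"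

text \<open>
  Near the origin and off the axes, \<open>R\<close> is a sum of terms that scale with factors
  \<open>a\<^sup>\<kappa>\<close>, \<open>\<kappa> \<ge> k\<close>, under \<open>(x, y) \<rightarrow> (a x, a y)\<close>. The Landau bound
  makes the estimate uniform in the direction of \<open>(x, y)\<close>.
\<close>

definition terms_of_order :: "real \<Rightarrow> (real \<Rightarrow> real \<Rightarrow> real) \<Rightarrow> bool" where
  "terms_of_order k R \<longleftrightarrow>
     (\<exists>(\<kappa> :: nat \<Rightarrow> real) (h :: nat \<Rightarrow> real \<Rightarrow> real \<Rightarrow> real).
        strict_mono \<kappa> \<and> (\<forall>n. k \<le> \<kappa> n) \<and>
        (\<forall>n a x y. a > 0 \<longrightarrow> h n (a * x) (a * y) = a powr \<kappa> n * h n x y) \<and>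
        (\<forall>\<^sub>F (x, y) in at (0, 0) within off_axes. (\<lambda>n. h n x y) sums R x y)) \<and>
     (\<lambda>(x, y). R x y) \<in> O[at (0, 0) within off_axes](\<lambda>(x, y). sqrt (x^2 + y^2) powr k)"

definition \<omega>_plus :: "real \<Rightarrow> real \<Rightarrow> real" where
  "\<omega>_plus x y = sqrt (x^2 + y^2 + y * sqrt (x^2 + y^2))"

definition \<omega>_minus :: "real \<Rightarrow> real \<Rightarrow> real" where
  "\<omega>_minus x y = sqrt (x^2 + y^2 - y * sqrt (x^2 + y^2))"

definition weak_field_part :: "real \<Rightarrow> real \<Rightarrow> real \<Rightarrow> real" where
  "weak_field_part \<psi> x y =
     - \<psi> * (arctan (x / y) / 2 + sgn x * arctan (\<omega>_plus x y / \<omega>_minus x y))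
     + \<psi> * ((y + sqrt (x^2 + y^2)) * \<omega>_plus x y + \<bar>x\<bar> * \<omega>_minus x y)
         / (sqrt 2 * (x^2 + y^2) powr (3/4) * sgn x)"

end

theory Submission
  imports Defs "HOL-Complex_Analysis.Cauchy_Integral_Formula"
begin

text \<open>
  Put \<open>z = s - \<i> p\<close> and \<open>r = csqrt (1 + \<i> \<psi> / z)\<close>. Then \<open>t_plus + \<i> t_minus = sqrt 2 * r\<close>, and the
  Lagrangian is the real part of \<open>z r + \<i> \<psi> Ln (1 + r)\<close> minus \<open>\<psi>/2 * arctan (s/p)\<close>. Because
  \<open>z r\<^sup>2 = z + \<i> \<psi>\<close>, the \<open>z\<close>-derivative of this potential is \<open>r - \<i> \<psi> / (2 z)\<close>, whose second term is
  cancelled by the arctangent. The duality condition is then the imaginary part of \<open>z r\<^sup>2 = z + \<i> \<psi>\<close>.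

  For weak fields the potential is, up to a logarithm, an odd holomorphic function of
  \<open>q = csqrt (- \<i> z / \<psi>)\<close>. Its Taylor coefficients of order 0 and 2 vanish, so everything beyond the
  linear term is of order \<open>3/2\<close> in the fields. The logarithm contributes a term depending only on the
  direction of \<open>(s, p)\<close>, which has different limits along the two diagonals; this
  excludes analyticity at the origin.
\<close>

section \<open>The complex potential\<close>

text \<open>This is multiplicativity of the complex modulus: with z = s - \<i> p both sides equal |z
  + \<i> \<psi>|^2 / |z|^2, the right one read off from the real and imaginary parts of 1 + \<i>
  \<psi> / z.\<close>

lemma discriminant_identity:
  fixes s p \<psi> :: real
  assumes "s^2 + p^2 \<noteq> 0"
  shows "(s^2 + (\<psi> - p)^2) / (s^2 + p^2) =
    \<psi>^2 * s^2 / (s^2 + p^2)^2 + (1 - \<psi> * p / (s^2 + p^2))^2"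
proof -
  define D where "D = s^2 + p^2"
  have D: "D \<noteq> 0" using assms by (simp add: D_def)
  have "(s^2 + (\<psi> - p)^2) * D = \<psi>^2 * s^2 + (D - \<psi> * p)^2"
    unfolding D_def by algebra
  moreover have "(1 - \<psi> * p / D)^2 = (D - \<psi> * p)^2 / D^2"
    using D by (simp add: field_simps)
  ultimately have "\<psi>^2 * s^2 / D^2 + (1 - \<psi> * p / D)^2 = (s^2 + (\<psi> - p)^2) * D / D^2"
    by (simp add: add_divide_distrib)
  then show ?thesis using D by (simp add: power2_eq_square D_def)
qed

section \<open>The complex radicand and its principal square root\<close>

definition dual_radicand :: "real \<Rightarrow> real \<Rightarrow> real \<Rightarrow> complex" where
  "dual_radicand s p \<psi> = 1 + \<i> * of_real \<psi> / Complex s (- p)"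

lemma dual_radicand_eq:
  "dual_radicand s p \<psi> = Complex (1 - \<psi> * p / (s^2 + p^2)) (\<psi> * s / (s^2 + p^2))"
  by (simp add: dual_radicand_def complex_eq_iff Re_divide Im_divide)

lemma norm_dual_radicand:
  assumes "s^2 + p^2 \<noteq> 0"
  shows "cmod (dual_radicand s p \<psi>) = sqrt ((s^2 + (\<psi> - p)^2) / (s^2 + p^2))"
  unfolding dual_radicand_eq discriminant_identity[OF assms]
  by (simp add: cmod_def power_divide power_mult_distrib add.commute)

text \<open>For w = \<open>dual_radicand s p \<psi>\<close> the outer radicand of
  \<open>t_plus\<close> is Re w + |w|, so this is the half-angle formula Re (csqrt w) = sqrt ((|w| +
  Re w) / 2).\<close>

lemma t_plus_eq_Re_csqrt:
  assumes "s^2 + p^2 \<noteq> 0"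
  shows "t_plus s p \<psi> = sqrt 2 * Re (csqrt (dual_radicand s p \<psi>))"
  by (simp add: t_plus_def norm_dual_radicand[OF assms] real_sqrt_mult[symmetric])
     (simp add: dual_radicand_eq)

text \<open>The square root brings out |\<psi> s|, and division by \<psi> s leaves its sign. This is
  the sign of Im w, which the principal root of the radicand w hands to its own imaginary
  part.\<close>

lemma t_minus_eq_Im_csqrt:
  assumes "s \<noteq> 0" "\<psi> \<noteq> 0"
  shows "t_minus s p \<psi> = sqrt 2 * Im (csqrt (dual_radicand s p \<psi>))"
proof -
  have D: "s^2 + p^2 > 0" using assms by (simp add: sum_power2_gt_zero_iff)
  define W where "W = sqrt ((s^2 + (\<psi> - p)^2) / (s^2 + p^2))"
  have sg: "sgn (\<psi> * s / (s^2 + p^2)) = sgn (\<psi> * s)" using D by (simp add: sgn_divide)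
  have "t_minus s p \<psi> = 1 / (\<psi> * s) * (\<bar>\<psi> * s\<bar> * sqrt (W - (1 - \<psi> * p / (s^2 + p^2))))"
  proof -
    have "sqrt (\<psi>^2 * s^2 * X) = \<bar>\<psi> * s\<bar> * sqrt X" for X
      by (simp add: real_sqrt_mult abs_mult)
    moreover have "\<psi> * p / (s^2 + p^2) - 1 + W = W - (1 - \<psi> * p / (s^2 + p^2))" by simp
    ultimately show ?thesis unfolding t_minus_def W_def[symmetric] by (simp only:)
  qed
  also have "\<dots> = sgn (\<psi> * s) * sqrt (W - (1 - \<psi> * p / (s^2 + p^2)))"
    using assms by (simp add: sgn_if abs_if)
  also have "\<dots> = sqrt 2 * Im (csqrt (dual_radicand s p \<psi>))"
    using assms D sg unfolding csqrt.sel norm_dual_radicand[OF less_imp_neq[OF D, symmetric]] W_def[symmetric]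
    by (simp add: dual_radicand_eq real_sqrt_divide)
  finally show ?thesis .
qed

lemma dual_radicand_notin_nonpos_Reals:
  assumes "s \<noteq> 0" "\<psi> \<noteq> 0"
  shows "dual_radicand s p \<psi> \<notin> \<real>\<^sub>\<le>\<^sub>0"
  using assms by (auto simp: dual_radicand_eq complex_nonpos_Reals_iff sum_power2_eq_zero_iff)

text \<open>Both identities are the real and imaginary parts of r^2 = w, where r is the principal
  root of the radicand w.\<close>

lemma t_identities:
  assumes "s \<noteq> 0" "\<psi> \<noteq> 0"
  shows "(t_plus s p \<psi>)^2 = (t_minus s p \<psi>)^2 + 2 - 2 * \<psi> * p / (s^2 + p^2)"
    and "t_plus s p \<psi> * t_minus s p \<psi> = \<psi> * s / (s^2 + p^2)"
proof -
  have D: "s^2 + p^2 \<noteq> 0" using assms by (simp add: sum_power2_eq_zero_iff)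
  define r where "r = csqrt (dual_radicand s p \<psi>)"
  have "r^2 = dual_radicand s p \<psi>" by (simp add: r_def del: csqrt.simps)
  then have "Re (r^2) = 1 - \<psi> * p / (s^2 + p^2)" "Im (r^2) = \<psi> * s / (s^2 + p^2)"
    by (simp_all add: dual_radicand_eq)
  then have *: "(Re r)^2 - (Im r)^2 = 1 - \<psi> * p / (s^2 + p^2)" "2 * Re r * Im r = \<psi> * s / (s^2 + p^2)"
    by (simp_all add: Re_power2 Im_power2)
  have eq: "t_plus s p \<psi> = sqrt 2 * Re r" "t_minus s p \<psi> = sqrt 2 * Im r"
    using t_plus_eq_Re_csqrt[OF D] t_minus_eq_Im_csqrt[OF assms] by (simp_all only: r_def)
  show "(t_plus s p \<psi>)^2 = (t_minus s p \<psi>)^2 + 2 - 2 * \<psi> * p / (s^2 + p^2)"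
    using *(1) by (simp add: eq power_mult_distrib mult.assoc times_divide_eq_right[symmetric]
        del: times_divide_eq_right)
  show "t_plus s p \<psi> * t_minus s p \<psi> = \<psi> * s / (s^2 + p^2)"
    using *(2) by (simp add: eq algebra_simps)
qed

text \<open>The product \<open>t_plus * t_minus\<close> does not vanish, hence neither does the real
  part of the root. Strict positivity keeps 1 + r away from the branch cut of
  \<open>Ln\<close>.\<close>

lemma Re_csqrt_dual_radicand_pos:
  assumes "s \<noteq> 0" "\<psi> \<noteq> 0"
  shows "Re (csqrt (dual_radicand s p \<psi>)) > 0"
proof -
  have "Re (csqrt (dual_radicand s p \<psi>)) \<noteq> 0"
    using t_identities(2)[OF assms, of p] assms
    by (auto simp: t_plus_eq_Re_csqrt sum_power2_eq_zero_iff simp del: csqrt.simps)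
  then show ?thesis using Re_csqrt[of "dual_radicand s p \<psi>"] by linarith
qed

text \<open>Since 1 + r has positive real part, its argument is arctan (Im r / (1 + Re r)). After
  cancelling sqrt 2 this is the second arctangent of \<open>t_psi\<close>.\<close>

lemma L_psiM_complex_form:
  fixes s p \<psi> :: real
  assumes "s \<noteq> 0" "\<psi> \<noteq> 0"
  defines "r \<equiv> csqrt (dual_radicand s p \<psi>)"
  shows "L_psiM s p \<psi> = Re (Complex s (- p) * r + \<i> * of_real \<psi> * Ln (1 + r)) - \<psi> / 2 * arctan (s / p)"
    and "t_psi s p \<psi> = arctan (s / p) + 2 * Im (Ln (1 + r))"
proof -
  have D: "s^2 + p^2 \<noteq> 0" using assms by (simp add: sum_power2_eq_zero_iff)
  have eq: "t_plus s p \<psi> = sqrt 2 * Re r" "t_minus s p \<psi> = sqrt 2 * Im r"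
    using t_plus_eq_Re_csqrt[OF D] t_minus_eq_Im_csqrt[OF assms(1,2)] by (simp_all only: r_def)
  have pos: "Re r > 0" unfolding r_def by (rule Re_csqrt_dual_radicand_pos[OF assms(1,2)])
  have "Im (Ln (1 + r)) = arctan (Im (1 + r) / Re (1 + r))"
    using pos by (subst Im_Ln_eq) (auto simp: complex_eq_iff)
  moreover have "sqrt 2 * Im r / (sqrt 2 + sqrt 2 * Re r) = Im r / (1 + Re r)"
  proof -
    have "sqrt 2 * Im r / (sqrt 2 * (1 + Re r)) = Im r / (1 + Re r)" by simp
    then show ?thesis by (simp only: distrib_left mult_1_right)
  qed
  ultimately show t: "t_psi s p \<psi> = arctan (s / p) + 2 * Im (Ln (1 + r))"
    by (simp add: t_psi_def eq)
  show "L_psiM s p \<psi> = Re (Complex s (- p) * r + \<i> * of_real \<psi> * Ln (1 + r)) - \<psi> / 2 * arctan (s / p)"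
    by (simp add: L_psiM_def t eq algebra_simps)
qed

text \<open>Differentiating along an arbitrary curve yields the three partial derivatives as well as
  the chain rule for the ModMax substitution.\<close>

lemma L_psiM_has_real_derivative_along_curve:
  assumes S: "(S has_real_derivative S') (at t)" and P: "(P has_real_derivative P') (at t)"
    and Q: "(Q has_real_derivative Q') (at t)"
    and nz: "S t \<noteq> 0" "P t \<noteq> 0" "Q t \<noteq> 0"
  shows "((\<lambda>x. L_psiM (S x) (P x) (Q x)) has_real_derivative
    t_plus (S t) (P t) (Q t) / sqrt 2 * S' + t_minus (S t) (P t) (Q t) / sqrt 2 * P'
      - t_psi (S t) (P t) (Q t) / 2 * Q') (at t)"
proof -
  define Z where "Z x = Complex (S x) (- P x)" for x
  define W where "W x = dual_radicand (S x) (P x) (Q x)" for x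
  define r where "r x = csqrt (W x)" for x
  define D where "D = (S t)^2 + (P t)^2"
  have D: "D \<noteq> 0" using nz by (simp add: D_def sum_power2_eq_zero_iff)
  define Z' where "Z' = Complex S' (- P')"
  define W' where "W' = \<i> * of_real Q' / Z t - \<i> * of_real (Q t) * Z' / (Z t)^2"
  define r' where "r' = W' / (2 * r t)"
  have Zt: "Z t \<noteq> 0" using nz by (simp add: Z_def complex_eq_iff)
  have Wt: "W t \<notin> \<real>\<^sub>\<le>\<^sub>0" unfolding W_def by (rule dual_radicand_notin_nonpos_Reals) (use nz in auto)
  have rpos: "Re (r t) > 0" unfolding r_def W_def by (rule Re_csqrt_dual_radicand_pos) (use nz in auto)
  then have rt: "r t \<noteq> 0" "1 + r t \<noteq> 0" "1 + r t \<notin> \<real>\<^sub>\<le>\<^sub>0"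
    by (auto simp: complex_eq_iff complex_nonpos_Reals_iff)
  have Zd: "(Z has_vector_derivative Z') (at t)"
    unfolding Z_def Z'_def has_vector_derivative_complex_iff using S P
    by (auto intro!: derivative_eq_intros simp: has_real_derivative_iff_has_vector_derivative[symmetric])
  have Qd: "((\<lambda>x. complex_of_real (Q x)) has_vector_derivative of_real Q') (at t)"
    using Q by (simp add: has_vector_derivative_of_real)
  have inv: "((\<lambda>x. inverse (Z x)) has_vector_derivative Z' * (- inverse (Z t ^ 2))) (at t)"
  proof -
    have "(inverse has_field_derivative - inverse (Z t ^ 2)) (at (Z t))"
      using DERIV_inverse[OF Zt] by (simp only: power_Suc power_0 mult_1_right power2_eq_square inverse_mult_distrib)
    from field_vector_diff_chain_at[OF Zd this] show ?thesis by (simp only: o_def)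
  qed
  have Wd: "(W has_vector_derivative W') (at t)"
  proof -
    have "((\<lambda>x. 1 + \<i> * (of_real (Q x) * inverse (Z x))) has_vector_derivative
        0 + \<i> * (of_real (Q t) * (Z' * (- inverse (Z t ^ 2))) + of_real Q' * inverse (Z t))) (at t)"
      by (intro has_vector_derivative_add has_vector_derivative_const has_vector_derivative_mult_right
          has_vector_derivative_mult Qd inv)
    moreover have "(\<lambda>x. 1 + \<i> * (of_real (Q x) * inverse (Z x))) = W"
      by (simp add: W_def Z_def dual_radicand_def fun_eq_iff divide_inverse mult.assoc)
    ultimately show ?thesis by (simp add: W'_def divide_inverse algebra_simps)
  qed
  have rd: "(r has_vector_derivative r') (at t)"
    using field_vector_diff_chain_at[OF Wd has_field_derivative_csqrt[OF Wt]]
    by (simp only: r_def[abs_def] r'_def o_def divide_inverse)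
  have "((\<lambda>x. 1 + r x) has_vector_derivative r') (at t)"
    using has_vector_derivative_add[OF has_vector_derivative_const rd, of 1] by simp
  from field_vector_diff_chain_at[OF this has_field_derivative_Ln[OF rt(3)]]
  have lnd: "((\<lambda>x. Ln (1 + r x)) has_vector_derivative r' / (1 + r t)) (at t)"
    by (simp add: o_def divide_inverse)
  define K where "K x = Z x * r x + \<i> * (of_real (Q x) * Ln (1 + r x))" for x
  define K' where "K' = Z t * r' + Z' * r t + \<i> * (of_real (Q t) * (r' / (1 + r t)) + of_real Q' * Ln (1 + r t))"
  have "(K has_vector_derivative K') (at t)"
    unfolding K_def K'_def
    by (intro has_vector_derivative_add has_vector_derivative_mult_right has_vector_derivative_mult Zd rd Qd lnd)
  then have Kd: "((\<lambda>x. Re (K x)) has_real_derivative Re K') (at t)"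
    by (simp add: has_vector_derivative_complex_iff)
  have ad: "((\<lambda>x. Q x / 2 * arctan (S x / P x)) has_real_derivative
      Q' / 2 * arctan (S t / P t) + Q t / 2 * ((S' * P t - S t * P') / D)) (at t)"
  proof -
    have *: "(S' * P t - S t * P') / (P t * P t) / (1 + (S t / P t)\<^sup>2) = (S' * P t - S t * P') / D"
    proof -
      have "P t * P t * (1 + (S t / P t)\<^sup>2) = D"
        using nz by (simp add: D_def power2_eq_square field_simps)
      then show ?thesis by (metis divide_divide_eq_left)
    qed
    have "((\<lambda>x. S x / P x) has_real_derivative (S' * P t - S t * P') / (P t * P t)) (at t)"
      by (rule DERIV_divide[OF S P nz(2)])
    from DERIV_chain2[OF DERIV_arctan this]
    have "((\<lambda>x. arctan (S x / P x)) has_real_derivative (S' * P t - S t * P') / D) (at t)"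
      unfolding *[symmetric] by (simp add: divide_inverse mult.commute)
    from DERIV_mult'[OF DERIV_cdivide[OF Q, of 2] this] show ?thesis
      by (simp add: add.commute)
  qed
  \<comment> \<open>Since \<open>\<i> Q = Z (r - 1) (r + 1)\<close>, the derivative of the logarithm cancels all but \<open>Z r r' = Z W' / 2\<close>.\<close>
  have "r t ^ 2 = W t" by (simp add: r_def del: csqrt.simps)
  then have key: "\<i> * of_real (Q t) = Z t * (r t - 1) * (r t + 1)"
    using Zt by (simp add: W_def dual_radicand_def Z_def[symmetric] field_simps power2_eq_square)
  have "\<i> * (of_real (Q t) * (r' / (1 + r t))) = Z t * (r t - 1) * r'"
  proof -
    have "\<i> * (of_real (Q t) * (r' / (1 + r t))) = Z t * (r t - 1) * (r t + 1) * r' / (1 + r t)"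
      by (simp flip: key)
    also have "\<dots> = Z t * (r t - 1) * r' * ((r t + 1) / (1 + r t))"
      by simp
    finally show ?thesis using rt(2) by (simp add: add.commute)
  qed
  then have "K' = Z' * r t + Z t * (r t * r') + \<i> * of_real Q' * Ln (1 + r t)"
    by (simp add: K'_def algebra_simps)
  also have "Z t * (r t * r') = Z t * W' / 2" using rt by (simp add: r'_def)
  also have "\<dots> = (\<i> * of_real Q' - of_real (Q t) * (\<i> * (Z' / Z t))) / 2"
    using Zt by (simp add: W'_def field_simps power2_eq_square)
  finally have K'2: "K' = Z' * r t + (\<i> * of_real Q' - of_real (Q t) * (\<i> * (Z' / Z t))) / 2
      + \<i> * of_real Q' * Ln (1 + r t)" .
  define E where "E = (S' * P t - S t * P') / D"
  define X where "X = Z' / Z t"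
  \<comment> \<open>The imaginary part of Z'/Z is the same fraction \<open>E\<close> that
    differentiating arctan (S/P) produced, so the two contributions cancel in the final
    difference.\<close>
  have ImX: "Im X = (S' * P t - P' * S t) / D"
    by (simp add: X_def Z'_def Z_def Im_divide D_def add.commute)
  have ReK: "Re K' = S' * Re (r t) + P' * Im (r t) + Q t * ((S' * P t - S t * P') / D) / 2 - Q' * Im (Ln (1 + r t))"
    by (simp add: K'2[folded X_def] Z'_def ImX algebra_simps)
  have eq: "t_plus (S t) (P t) (Q t) / sqrt 2 = Re (r t)" "t_minus (S t) (P t) (Q t) / sqrt 2 = Im (r t)"
    using t_plus_eq_Re_csqrt[of "S t" "P t" "Q t"] t_minus_eq_Im_csqrt[of "S t" "Q t" "P t"] nz
    by (simp_all add: r_def W_def sum_power2_eq_zero_iff del: csqrt.simps)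
  have tp: "t_psi (S t) (P t) (Q t) = arctan (S t / P t) + 2 * Im (Ln (1 + r t))"
    unfolding r_def W_def by (rule L_psiM_complex_form) (use nz in auto)
  have "((\<lambda>x. Re (K x) - Q x / 2 * arctan (S x / P x)) has_real_derivative
    Re (r t) * S' + Im (r t) * P' - t_psi (S t) (P t) (Q t) / 2 * Q') (at t)"
    by (rule DERIV_cong[OF DERIV_diff[OF Kd ad[folded E_def]]]) (simp add: ReK[folded E_def] tp field_simps)
  moreover have "\<forall>\<^sub>F x in nhds t. L_psiM (S x) (P x) (Q x) = Re (K x) - Q x / 2 * arctan (S x / P x)"
  proof -
    have "\<forall>\<^sub>F x in nhds t. S x \<noteq> 0" "\<forall>\<^sub>F x in nhds t. Q x \<noteq> 0"
      using DERIV_isCont[OF S] DERIV_isCont[OF Q] nz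
      by (auto simp: isCont_def tendsto_nhds_iff intro!: tendsto_imp_eventually_ne)
    then show ?thesis
      by eventually_elim
        (simp add: L_psiM_complex_form(1) K_def r_def W_def Z_def mult.assoc del: csqrt.simps)
  qed
  ultimately show ?thesis
    unfolding eq by (subst DERIV_cong_ev[OF refl _ refl]) auto
qed

section \<open>Partial derivatives, duality condition and homogeneity\<close>

lemma L_psiM_partial_derivatives:
  assumes "s \<noteq> 0" "p \<noteq> 0" "\<psi> \<noteq> 0"
  shows "((\<lambda>s'. L_psiM s' p \<psi>) has_real_derivative t_plus s p \<psi> / sqrt 2) (at s)"
    and "((\<lambda>p'. L_psiM s p' \<psi>) has_real_derivative t_minus s p \<psi> / sqrt 2) (at p)"
    and "((\<lambda>\<psi>'. L_psiM s p \<psi>') has_real_derivative - (t_psi s p \<psi> / 2)) (at \<psi>)"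
  by (rule DERIV_cong[OF L_psiM_has_real_derivative_along_curve
        [OF DERIV_ident DERIV_const DERIV_const assms]], simp)
    (rule DERIV_cong[OF L_psiM_has_real_derivative_along_curve
        [OF DERIV_const DERIV_ident DERIV_const assms]], simp,
     rule DERIV_cong[OF L_psiM_has_real_derivative_along_curve
        [OF DERIV_const DERIV_const DERIV_ident assms]], simp)

text \<open>With r = a + \<i> b the left side is - Im (z r^2), and z r^2 = z + \<i> \<psi>. The
  purely algebraic form allows reuse with the ModMax value in place of s.\<close>

lemma t_duality:
  fixes s p \<psi> :: real
  assumes "s \<noteq> 0" "\<psi> \<noteq> 0"
  defines "a \<equiv> t_plus s p \<psi> / sqrt 2" and "b \<equiv> t_minus s p \<psi> / sqrt 2"
  shows "p * a^2 - 2 * s * a * b - p * b^2 = p - \<psi>"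
proof -
  define D where "D = s^2 + p^2"
  have D: "D \<noteq> 0" using assms by (simp add: D_def sum_power2_eq_zero_iff)
  have "2 * a * b = t_plus s p \<psi> * t_minus s p \<psi>" by (simp add: a_def b_def)
  then have "a^2 - b^2 = 1 - \<psi> * p / D" "2 * a * b = \<psi> * s / D"
    using t_identities[OF assms(1,2), of p]
    by (simp_all add: a_def b_def D_def power_divide mult.assoc flip: diff_divide_distrib)
  then have "p * a^2 - 2 * s * a * b - p * b^2 = p * (1 - \<psi> * p / D) - s * (\<psi> * s / D)"
    by algebra
  also have "\<dots> = p - \<psi> * ((s^2 + p^2) / D)"
    by (simp add: power2_eq_square algebra_simps add_divide_distrib)
  also have "(s^2 + p^2) / D = 1" using D unfolding D_def by (rule divide_self)
  finally show ?thesis by simp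
qed

lemma duality_invariant_L_psiM:
  assumes "s \<noteq> 0" "p \<noteq> 0" "\<psi> \<noteq> 0"
  shows "duality_invariant_at L_psiM s p \<psi>"
  unfolding duality_invariant_at_def
  by (intro exI[of _ "t_plus s p \<psi> / sqrt 2"] exI[of _ "t_minus s p \<psi> / sqrt 2"] conjI
      L_psiM_partial_derivatives assms) (simp only: t_duality[OF assms(1,3)] diff_add_cancel)

lemma homogeneity_L_psiM:
  assumes "s \<noteq> 0" "p \<noteq> 0" "\<psi> \<noteq> 0"
  shows "homogeneity_condition_at L_psiM s p \<psi>"
  unfolding homogeneity_condition_at_def
  by (intro exI[of _ "t_plus s p \<psi> / sqrt 2"] exI[of _ "t_minus s p \<psi> / sqrt 2"]
      exI[of _ "- (t_psi s p \<psi> / 2)"] conjI L_psiM_partial_derivatives assms) (simp add: L_psiM_def)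

section \<open>The Maxwell limit\<close>

lemma t_psi_bounded: "\<bar>t_psi s p \<psi>\<bar> \<le> 2 * pi"
  using arctan_bounded[of "s / p"] arctan_bounded[of "t_minus s p \<psi> / (sqrt 2 + t_plus s p \<psi>)"]
  unfolding t_psi_def abs_le_iff by linarith

text \<open>The angular term is \<psi> times a bounded function. For nonzero s the root r tends to
  1, whose real part keeps s and whose imaginary part removes p.\<close>

lemma L_psiM_tendsto_Maxwell: "((\<lambda>\<psi>. L_psiM s p \<psi>) \<longlongrightarrow> s) (at 0)"
proof -
  have psi: "((\<lambda>\<psi>. \<psi> / 2 * t_psi s p \<psi>) \<longlongrightarrow> 0) (at 0)"
  proof (rule Lim_null_comparison)
    show "\<forall>\<^sub>F \<psi> in at 0. norm (\<psi> / 2 * t_psi s p \<psi>) \<le> \<bar>\<psi>\<bar> * pi"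
      using mult_left_mono[OF t_psi_bounded, of "\<bar>\<psi>\<bar>" s p \<psi> for \<psi>] by (simp add: abs_mult field_simps)
    show "((\<lambda>\<psi>. \<bar>\<psi>\<bar> * pi) \<longlongrightarrow> 0) (at 0)"
      by (auto intro!: tendsto_eq_intros)
  qed
  show ?thesis
  proof (cases "s = 0")
    case True
    \<comment> \<open>At s = 0 the prefactor 1 / (\<psi> s) is 0 by the division convention, so only
      the angular term survives.\<close>
    then have "L_psiM s p = (\<lambda>\<psi>. - (\<psi> / 2 * t_psi s p \<psi>))"
      by (simp add: L_psiM_def t_minus_def fun_eq_iff)
    then show ?thesis using tendsto_minus[OF psi] True by simp
  next
    case False
    define D where "D = s^2 + p^2"
    have D: "D > 0" using False by (simp add: D_def sum_power2_gt_zero_iff)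
    have W0: "dual_radicand s p 0 = 1" by (simp add: dual_radicand_def)
    have "isCont (\<lambda>\<psi>. csqrt (dual_radicand s p \<psi>)) 0"
      by (intro isCont_o2[OF _ continuous_at_csqrt])
        (use False in \<open>auto simp: dual_radicand_def[abs_def] complex_eq_iff intro!: continuous_intros\<close>)
    then have r: "((\<lambda>\<psi>. csqrt (dual_radicand s p \<psi>)) \<longlongrightarrow> 1) (at 0)"
      by (simp add: isCont_def W0 del: csqrt.simps)
    have "((\<lambda>\<psi>. s * Re (csqrt (dual_radicand s p \<psi>)) + p * Im (csqrt (dual_radicand s p \<psi>))
        - \<psi> / 2 * t_psi s p \<psi>) \<longlongrightarrow> s * Re 1 + p * Im 1 - 0) (at 0)"
      by (intro tendsto_intros r psi)
    moreover have "\<forall>\<^sub>F \<psi> in at 0.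
      s * Re (csqrt (dual_radicand s p \<psi>)) + p * Im (csqrt (dual_radicand s p \<psi>)) - \<psi> / 2 * t_psi s p \<psi> = L_psiM s p \<psi>"
      using eventually_neq_at_within[of 0]
      by eventually_elim
        (use False D in \<open>simp add: L_psiM_def t_minus_eq_Im_csqrt t_plus_eq_Re_csqrt D_def del: csqrt.simps csqrt.sel\<close>)
    ultimately show ?thesis using Lim_transform_eventually by fastforce
  qed
qed

section \<open>Reality\<close>

text \<open>The discriminant identity gives |u| \<le> W, so the outer radicands involve only the
  nonnegative numbers W + u and W - u, and the principal complex roots agree with the real
  ones.\<close>

lemma L_psiM_complex_of_real: "L_psiM_complex (of_real s) (of_real p) (of_real \<psi>) = of_real (L_psiM s p \<psi>)"
proof -
  define D where "D = s^2 + p^2"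
  define W where "W = sqrt ((s^2 + (\<psi> - p)^2) / D)"
  define u where "u = 1 - \<psi> * p / D"
  have uW: "\<bar>u\<bar> \<le> W" if "D \<noteq> 0"
    using discriminant_identity[of s p \<psi>] that unfolding W_def u_def D_def
    by (intro real_le_rsqrt) auto
  \<comment> \<open>At s = p = 0 division by zero yields W - u = -1, but the factor s^2 = 0 still
    makes the radicand \<open>V\<close> nonnegative.\<close>
  have u0: "u = 1" "W = 0" "s = 0" if "D = 0" using that by (auto simp: u_def W_def D_def sum_power2_eq_zero_iff)
  have inner: "csqrt (((of_real s)^2 + (of_real \<psi> - of_real p)^2) / ((of_real s)^2 + (of_real p)^2)) = of_real W"
  proof -
    have "((of_real s)^2 + (of_real \<psi> - of_real p)^2) / ((of_real s)^2 + (of_real p)^2)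
        = complex_of_real ((s^2 + (\<psi> - p)^2) / D)" by (simp add: D_def)
    then show ?thesis unfolding W_def by (simp only: csqrt_of_real D_def) (simp add: csqrt_of_real del: of_real_divide csqrt.simps)
  qed
  have u: "1 - of_real \<psi> * of_real p / ((of_real s)^2 + (of_real p)^2) = complex_of_real u"
    by (simp add: u_def D_def)
  have "u + W \<ge> 0" using uW u0 by (cases "D = 0") force+
  from csqrt_of_real[OF this]
  have tp: "t_plus_complex (of_real s) (of_real p) (of_real \<psi>) = of_real (t_plus s p \<psi>)"
    unfolding t_plus_complex_def t_plus_def inner u of_real_add
    by (simp only: u_def W_def D_def)
  define V where "V = \<psi>^2 * s^2 * (W - u)"
  have "V \<ge> 0" using uW u0 by (cases "D = 0") (force simp: V_def intro!: mult_nonneg_nonneg)+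
  from csqrt_of_real[OF this] have "csqrt (of_real V) = of_real (sqrt V)" .
  moreover have "(of_real \<psi>)^2 * (of_real s)^2 *
      (of_real \<psi> * of_real p / ((of_real s)^2 + (of_real p)^2) - 1 + of_real W) = complex_of_real V"
    by (simp add: V_def u_def D_def algebra_simps)
  moreover have "\<psi>^2 * s^2 * (\<psi> * p / D - 1 + W) = V" by (simp add: V_def u_def algebra_simps)
  ultimately have tm: "t_minus_complex (of_real s) (of_real p) (of_real \<psi>) = of_real (t_minus s p \<psi>)"
    unfolding t_minus_complex_def t_minus_def inner
    by (simp only: W_def D_def) simp
  have c2: "csqrt 2 = of_real (sqrt 2)"
    by (metis csqrt_of_real of_real_numeral zero_le_numeral)
  have "t_psi_complex (of_real s) (of_real p) (of_real \<psi>) = of_real (t_psi s p \<psi>)"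
    unfolding t_psi_complex_def t_psi_def tp tm c2
    by (simp add: Arctan_of_real[symmetric])
  then show ?thesis unfolding L_psiM_complex_def L_psiM_def tp tm c2 by simp
qed

section \<open>The ModMax family\<close>

lemma L_MM_derivatives:
  assumes "p \<noteq> 0"
  shows "((\<lambda>s'. L_MM \<gamma> s' p) has_real_derivative cosh \<gamma> + sinh \<gamma> * s / sqrt (s^2 + p^2)) (at s)"
    and "((\<lambda>p'. L_MM \<gamma> s p') has_real_derivative sinh \<gamma> * p / sqrt (s^2 + p^2)) (at p)"
proof -
  have D: "s^2 + p^2 > 0" using assms by (simp add: sum_power2_gt_zero_iff)
  show "((\<lambda>s'. L_MM \<gamma> s' p) has_real_derivative cosh \<gamma> + sinh \<gamma> * s / sqrt (s^2 + p^2)) (at s)"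
    unfolding L_MM_def
    using assms by (auto intro!: derivative_eq_intros simp: field_simps sum_power2_gt_zero_iff not_sum_power2_lt_zero)
  show "((\<lambda>p'. L_MM \<gamma> s p') has_real_derivative sinh \<gamma> * p / sqrt (s^2 + p^2)) (at p)"
    unfolding L_MM_def
    using assms by (auto intro!: derivative_eq_intros simp: field_simps sum_power2_gt_zero_iff not_sum_power2_lt_zero)
qed

text \<open>After the chain rule the duality expression splits into a^2 times that of
  \<open>L_MM\<close>, which is p, minus 2 a b times s Ts + p Tp, which is T by Euler homogeneity,
  minus p b^2. What remains is \<open>t_duality\<close> at T.\<close>

lemma duality_invariant_ModMax_map:
  assumes "L_MM \<gamma> s p \<noteq> 0" "p \<noteq> 0" "\<psi> \<noteq> 0"
  shows "duality_invariant_at (ModMax_map \<gamma> L_psiM) s p \<psi>"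
proof -
  define N where "N = sqrt (s^2 + p^2)"
  have N: "N > 0" "N^2 = s^2 + p^2" using assms by (simp_all add: N_def sum_power2_gt_zero_iff)
  define T where "T = L_MM \<gamma> s p"
  define a where "a = t_plus T p \<psi> / sqrt 2"
  define b where "b = t_minus T p \<psi> / sqrt 2"
  define c where "c = cosh \<gamma>"
  define d where "d = sinh \<gamma>"
  define Ts where "Ts = c + d * s / N"
  define Tp where "Tp = d * p / N"
  note defs = T_def a_def b_def c_def d_def Ts_def Tp_def N_def
  have "((\<lambda>s'. ModMax_map \<gamma> L_psiM s' p \<psi>) has_real_derivative a * Ts) (at s)"
    using L_psiM_has_real_derivative_along_curve[OF L_MM_derivatives(1) DERIV_const DERIV_const,
        of p \<gamma> s p \<psi>] assms
    by (simp add: ModMax_map_def defs)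
  moreover have "((\<lambda>p'. ModMax_map \<gamma> L_psiM s p' \<psi>) has_real_derivative a * Tp + b) (at p)"
    using L_psiM_has_real_derivative_along_curve[OF L_MM_derivatives(2) DERIV_ident DERIV_const,
        of p \<gamma> s \<psi>] assms
    by (simp add: ModMax_map_def defs)
  moreover have "p * (a * Ts)^2 - 2 * s * (a * Ts) * (a * Tp + b) - p * (a * Tp + b)^2 + \<psi> = p"
  proof -
    have cd: "c^2 - d^2 = 1" by (simp add: c_def d_def hyperbolic_pythagoras)
    have NTs: "N * Ts = c * N + d * s" "N * Tp = d * p" using N by (simp_all add: Ts_def Tp_def field_simps)
    have "N * (s * Ts + p * Tp) = N * T"
    proof -
      have "N * (s * Ts + p * Tp) = s * (N * Ts) + p * (N * Tp)" by algebra
      also have "\<dots> = N * T" unfolding NTs using N(2) by (simp add: T_def L_MM_def N_def[symmetric] c_def d_def) algebra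
      finally show ?thesis .
    qed
    then have euler: "s * Ts + p * Tp = T" using N by simp
    \<comment> \<open>Multiplying by N^2 clears the denominators. The mixed terms in c d cancel,
      leaving p (c^2 - d^2) N^2.\<close>
    have "N^2 * (p * Ts^2 - 2 * s * Ts * Tp - p * Tp^2) = p * (N * Ts)^2 - 2 * s * (N * Ts) * (N * Tp) - p * (N * Tp)^2"
      by algebra
    also have "\<dots> = N^2 * p" unfolding NTs using N(2) cd by algebra
    finally have mm: "p * Ts^2 - 2 * s * Ts * Tp - p * Tp^2 = p" using N(1) by simp
    have "p * a^2 - 2 * T * a * b - p * b^2 = p - \<psi>"
      unfolding a_def b_def using assms by (intro t_duality) (auto simp: T_def)
    moreover have "p * (a * Ts)^2 - 2 * s * (a * Ts) * (a * Tp + b) - p * (a * Tp + b)^2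
        = a^2 * (p * Ts^2 - 2 * s * Ts * Tp - p * Tp^2) - 2 * a * b * (s * Ts + p * Tp) - p * b^2"
      by algebra
    ultimately show ?thesis unfolding mm euler by (simp add: algebra_simps)
  qed
  ultimately show ?thesis unfolding duality_invariant_at_def by blast
qed

lemma ModMax_map_tendsto: "((\<lambda>\<psi>. ModMax_map \<gamma> L_psiM s p \<psi>) \<longlongrightarrow> L_MM \<gamma> s p) (at 0)"
  unfolding ModMax_map_def by (rule L_psiM_tendsto_Maxwell)

text \<open>The limit \<psi> to 0 recovers \<open>L_MM\<close>, whose value at s = 0, p = 1 is the
  injective function sinh \<gamma>. The family thus really has one parameter.\<close>

lemma inj_ModMax_map: "inj (\<lambda>\<gamma>. ModMax_map \<gamma> L_psiM)"
proof (rule injI)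
  fix \<gamma> \<gamma>' assume "ModMax_map \<gamma> L_psiM = ModMax_map \<gamma>' L_psiM"
  then have "L_MM \<gamma> 0 1 = L_MM \<gamma>' 0 1"
    using ModMax_map_tendsto[of \<gamma> 0 1] ModMax_map_tendsto[of \<gamma>' 0 1]
    by (auto intro: tendsto_unique[OF trivial_limit_at])
  then show "\<gamma> = \<gamma>'" by (simp add: L_MM_def)
qed

section \<open>Weak fields\<close>

text \<open>The radicand depends only on z / \<psi>, and s / p is unaffected by a common factor of
  either sign.\<close>

lemma L_psiM_scale:
  assumes "s \<noteq> 0" "\<psi> \<noteq> 0"
  shows "L_psiM s p \<psi> = \<psi> * L_psiM (s / \<psi>) (p / \<psi>) 1"
proof -
  have D: "s^2 + p^2 \<noteq> 0" "(s / \<psi>)^2 + (p / \<psi>)^2 \<noteq> 0"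
    using assms by (simp_all add: sum_power2_eq_zero_iff)
  have "dual_radicand s p \<psi> = dual_radicand (s / \<psi>) (p / \<psi>) 1"
  proof -
    have "Complex s (- p) = of_real \<psi> * Complex (s / \<psi>) (- (p / \<psi>))"
      using assms by (simp add: complex_eq_iff)
    then show ?thesis using assms by (simp add: dual_radicand_def)
  qed
  then have "t_plus s p \<psi> = t_plus (s / \<psi>) (p / \<psi>) 1" "t_minus s p \<psi> = t_minus (s / \<psi>) (p / \<psi>) 1"
    using assms D by (simp_all add: t_plus_eq_Re_csqrt t_minus_eq_Im_csqrt del: csqrt.simps csqrt.sel)
  then show ?thesis using assms by (simp add: L_psiM_def t_psi_def algebra_simps)
qed

text \<open>
  With \<open>\<psi> = 1\<close>, \<open>z = x - \<i> y\<close> and \<open>q = csqrt (- \<i> z)\<close> one has \<open>csqrt (1 + \<i>/z) = csqrt (1 + q\<^sup>2) / q\<close>,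
  so the holomorphic potential becomes \<open>\<i> (q csqrt (1 + q\<^sup>2) + Ln (q + csqrt (1 + q\<^sup>2)) - Ln q)\<close>.
\<close>

definition weak_root :: "real \<Rightarrow> real \<Rightarrow> complex" where
  "weak_root x y = csqrt (Complex (- y) (- x))"

definition weak_primitive :: "complex \<Rightarrow> complex" where
  "weak_primitive q = q * csqrt (1 + q^2) + Ln (q + csqrt (1 + q^2))"

definition weak_angle :: "real \<Rightarrow> real \<Rightarrow> real" where
  "weak_angle x y = Im (Ln (weak_root x y)) - arctan (x / y) / 2"

section \<open>Components and scaling of the weak-field root\<close>

lemma weak_root_power2: "weak_root x y ^ 2 = Complex (- y) (- x)"
  by (simp only: weak_root_def power2_csqrt)

lemma norm_weak_root: "cmod (weak_root x y) = sqrt (sqrt (x^2 + y^2))"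
  by (simp only: weak_root_def norm_csqrt) (simp add: cmod_def add.commute)

lemma Re_weak_root: "Re (weak_root x y) = sqrt ((sqrt (x^2 + y^2) - y) / 2)"
  by (simp add: weak_root_def cmod_def add.commute)

lemma Im_weak_root:
  assumes "x \<noteq> 0"
  shows "Im (weak_root x y) = - sgn x * sqrt ((sqrt (x^2 + y^2) + y) / 2)"
  using assms by (simp add: weak_root_def cmod_def add.commute sgn_minus)

lemma abs_less_sqrt_sum_squares:
  fixes x y :: real
  assumes "x \<noteq> 0"
  shows "\<bar>y\<bar> < sqrt (x^2 + y^2)"
  using assms by (intro real_less_rsqrt) simp

lemma Re_weak_root_pos:
  assumes "x \<noteq> 0"
  shows "Re (weak_root x y) > 0"
  using abs_less_sqrt_sum_squares[OF assms, of y] by (simp add: Re_weak_root)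

lemma Im_weak_root_nonzero:
  assumes "x \<noteq> 0"
  shows "Im (weak_root x y) \<noteq> 0"
  using abs_less_sqrt_sum_squares[OF assms, of y] assms by (simp add: Im_weak_root sgn_zero_iff)

lemma weak_root_scale:
  assumes "a > 0"
  shows "weak_root (a * x) (a * y) = of_real (sqrt a) * weak_root x y"
  unfolding weak_root_def
proof (rule csqrt_unique)
  have "Complex (- (a * y)) (- (a * x)) = of_real a * Complex (- y) (- x)"
    by (simp add: complex_eq_iff)
  then show "(of_real (sqrt a) * csqrt (Complex (- y) (- x)))^2 = Complex (- (a * y)) (- (a * x))"
    using assms by (simp add: power_mult_distrib flip: of_real_power del: csqrt.simps)
  show "0 < Re (of_real (sqrt a) * csqrt (Complex (- y) (- x))) \<or>
    Re (of_real (sqrt a) * csqrt (Complex (- y) (- x))) = 0 \<and>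
    0 \<le> Im (of_real (sqrt a) * csqrt (Complex (- y) (- x)))"
    using csqrt_principal[of "Complex (- y) (- x)"] assms by (simp add: zero_le_mult_iff zero_less_mult_iff del: csqrt.simps csqrt.sel)
qed

text \<open>A positive factor adds a real number to the logarithm, so its imaginary part depends
  only on the direction of (x, y).\<close>

lemma weak_angle_scale:
  assumes "a > 0" "x \<noteq> 0"
  shows "weak_angle (a * x) (a * y) = weak_angle x y"
proof -
  have "weak_root x y \<noteq> 0" using Re_weak_root_pos[OF assms(2), of y] by force
  then have "Ln (of_real (sqrt a) * weak_root x y) = of_real (ln (sqrt a)) + Ln (weak_root x y)"
    using Ln_times_of_real[of "sqrt a" "weak_root x y"] assms by (simp add: Ln_of_real)
  then show ?thesis using assms by (simp add: weak_angle_def weak_root_scale)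
qed

text \<open>Both arguments lie strictly between - pi/2 and pi/2, so their difference stays in the
  principal strip.\<close>

lemma Ln_divide_right_half_plane:
  assumes "Re a > 0" "Re b > 0"
  shows "Ln (a / b) = Ln a - Ln b"
proof (rule Ln_unique)
  have "a \<noteq> 0" "b \<noteq> 0" using assms by auto
  then show "exp (Ln a - Ln b) = a / b" by (simp add: exp_diff)
  show "- pi < Im (Ln a - Ln b)" "Im (Ln a - Ln b) \<le> pi"
    using Re_Ln_pos_lt_imp[OF assms(1)] Re_Ln_pos_lt_imp[OF assms(2)] by simp_all
qed

text \<open>The point is that S / q is the principal root. Both q and S have positive real part, and
  q^2 and S^2 share the imaginary part - x, so Im q and Im S have equal signs and Re (S / q) >
  0.\<close>

lemma L_psiM_weak_form:
  assumes "x \<noteq> 0"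
  shows "L_psiM x y 1 = weak_angle x y - Im (weak_primitive (weak_root x y))"
proof -
  define q where "q = weak_root x y"
  define S where "S = csqrt (1 + q^2)"
  have q2: "q^2 = Complex (- y) (- x)" by (simp add: q_def weak_root_power2)
  have S2: "S^2 = 1 + q^2" by (simp only: S_def power2_csqrt)
  have Req: "Re q > 0" unfolding q_def by (rule Re_weak_root_pos[OF assms])
  have q0: "q \<noteq> 0" using Req by auto
  have im: "Re q * Im q = - x / 2" "Re S * Im S = - x / 2"
  proof -
    have "Im (q^2) = - x" "Im (S^2) = - x" by (simp_all add: S2 q2)
    then show "Re q * Im q = - x / 2" "Re S * Im S = - x / 2" by (simp_all add: Im_power2)
  qed
  have "Re S \<noteq> 0" using im assms by auto
  moreover have "Re S \<ge> 0" unfolding S_def by (rule Re_csqrt)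
  ultimately have ReS: "Re S > 0" by simp
  have "Im S * Im q \<ge> 0"
  proof -
    have "(Re S * Re q) * (Im S * Im q) = (Re S * Im S) * (Re q * Im q)" by (simp only: mult_ac)
    also have "\<dots> = (x / 2)^2" unfolding im by (simp add: power2_eq_square)
    finally have "(Re S * Re q) * (Im S * Im q) \<ge> 0" by simp
    then show ?thesis
      using mult_pos_pos[OF ReS Req] by (simp only: zero_le_mult_iff[of "Re S * Re q"]) auto
  qed
  then have "Re S * Re q + Im S * Im q > 0" using Req ReS by (simp add: add_pos_nonneg)
  then have Rer: "Re (S / q) > 0" using q0 by (simp add: Re_divide complex_neq_0)
  have z: "Complex x (- y) = \<i> * q^2" by (simp add: q2 complex_eq_iff)
  have "dual_radicand x y 1 = (S / q)^2"
    unfolding dual_radicand_def z power_divide S2 using q0 by (simp add: field_simps)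
  then have r: "csqrt (dual_radicand x y 1) = S / q"
    using Rer by (intro csqrt_unique) auto
  have "Ln (1 + S / q) = Ln ((q + S) / q)" using q0 by (simp add: field_simps)
  also have "\<dots> = Ln (q + S) - Ln q"
    by (rule Ln_divide_right_half_plane) (use Req ReS in auto)
  finally have ln: "Ln (1 + S / q) = Ln (q + S) - Ln q" .
  have "Complex x (- y) * (S / q) = \<i> * (q * S)" using q0 unfolding z by (simp add: power2_eq_square)
  then have "L_psiM x y 1 = Re (\<i> * (q * S) + \<i> * (Ln (q + S) - Ln q)) - arctan (x / y) / 2"
    using L_psiM_complex_form(1)[OF assms, of 1 y] unfolding r ln by simp
  also have "\<dots> = weak_angle x y - Im (weak_primitive q)"
    by (simp add: weak_angle_def weak_primitive_def q_def[symmetric] S_def[symmetric] del: csqrt.simps)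
  finally show ?thesis by (simp add: q_def)
qed

text \<open>The logarithm is arsinh q, so the derivative is S + q^2 / S + 1 / S = 2 S with S^2 = 1 +
  q^2. The remaining work keeps both branches off their cuts.\<close>

lemma weak_primitive_has_field_derivative:
  assumes "cmod q < 1"
  shows "(weak_primitive has_field_derivative 2 * csqrt (1 + q^2)) (at q)"
proof -
  define S where "S = csqrt (1 + q^2)"
  have S2: "S^2 = 1 + q^2" by (simp only: S_def power2_csqrt)
  have "cmod (q^2) < 1" using assms by (simp add: norm_power power_less_one_iff)
  then have "Re (1 + q^2) > 0" using abs_Re_le_cmod[of "q^2"] by (simp add: abs_le_iff)
  then have nn: "1 + q^2 \<notin> \<real>\<^sub>\<le>\<^sub>0" by (auto simp: complex_nonpos_Reals_iff)
  then have S0: "S \<noteq> 0" using S2 by auto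
  have prod: "(S + q) * (S - q) = 1" using S2 by (simp add: power2_eq_square algebra_simps)
  \<comment> \<open>If q + S were a real c \<le> 0, then (S + q)(S - q) = 1 would give 2 S = c + 1/c
    < 0, against Re S \<ge> 0.\<close>
  have qS: "q + S \<notin> \<real>\<^sub>\<le>\<^sub>0"
  proof
    assume "q + S \<in> \<real>\<^sub>\<le>\<^sub>0"
    then obtain c where c: "q + S = of_real c" "c \<le> 0" by (auto elim: nonpos_Reals_cases)
    then have c0: "c < 0" using prod by (cases "c = 0") (auto simp: add.commute)
    have "of_real c * (S - q) = 1" using prod c by (simp add: add.commute)
    then have "S - q = of_real (1 / c)" using c0 by (simp add: field_simps)
    moreover have "2 * S = (q + S) + (S - q)" by simp
    ultimately have "2 * S = of_real (c + 1 / c)" using c(1) by (simp only: of_real_add)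
    from arg_cong[OF this, of Re] have "2 * Re S = c + 1 / c" by simp
    moreover have "c + 1 / c < 0" using c0 by (intro add_neg_neg) auto
    moreover have "Re S \<ge> 0" unfolding S_def by (rule Re_csqrt)
    ultimately show False by simp
  qed
  have q0: "q + S \<noteq> 0" using qS by auto
  have dS: "((\<lambda>q. csqrt (1 + q^2)) has_field_derivative q / S) (at q)"
    unfolding S_def using nn by (auto intro!: derivative_eq_intros simp del: csqrt.simps)
  have lnd: "((\<lambda>q. Ln (q + csqrt (1 + q^2))) has_field_derivative (1 + q / S) / (q + S)) (at q)"
  proof -
    have "((\<lambda>q. q + csqrt (1 + q^2)) has_field_derivative 1 + q / S) (at q)"
      by (intro DERIV_add DERIV_ident dS)
    from DERIV_chain2[OF has_field_derivative_Ln this] qS show ?thesis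
      unfolding S_def by (simp add: field_simps del: csqrt.simps csqrt.sel)
  qed
  have lneq: "(1 + q / S) / (q + S) = 1 / S"
  proof -
    have "1 + q / S = (q + S) / S" using S0 by (simp add: field_simps)
    then show ?thesis using q0 by simp
  qed
  have wd: "(weak_primitive has_field_derivative (q * (q / S) + 1 * S + 1 / S)) (at q)"
    using DERIV_add[OF DERIV_mult'[OF DERIV_ident dS] lnd[unfolded lneq]]
    by (simp only: weak_primitive_def[abs_def] S_def)
  have weq: "q * (q / S) + 1 * S + 1 / S = 2 * S"
  proof -
    have "q * (q / S) + 1 * S + 1 / S = (1 + q^2 + S^2) / S" using S0 by (simp add: field_simps power2_eq_square)
    also have "\<dots> = 2 * S" using S0 unfolding S2[symmetric] by (simp add: power2_eq_square)
    finally show ?thesis .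
  qed
  show ?thesis using wd[unfolded weq] by (simp only: S_def)
qed

text \<open>With m = sqrt (x^2 + y^2), \<omega>^+/\<omega>^- is the ratio of |Im q| to Re q for the
  root q, and the fraction collapses to - 2 Im q. The displayed leading part is therefore exactly
  the angle plus the linear Taylor term.\<close>

lemma weak_field_part_eq:
  assumes "x \<noteq> 0"
  shows "weak_field_part \<psi> x y = \<psi> * (weak_angle x y - 2 * Im (weak_root x y))"
proof -
  define m where "m = sqrt (x^2 + y^2)"
  define P where "P = sqrt (m + y)"
  define M where "M = sqrt (m - y)"
  have m: "\<bar>y\<bar> < m" unfolding m_def by (rule abs_less_sqrt_sum_squares[OF assms])
  have m0: "m > 0" using m by linarith
  have pos: "P > 0" "M > 0" using m by (simp_all add: P_def M_def)
  have sq: "P^2 = m + y" "M^2 = m - y" using m by (simp_all add: P_def M_def)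
  have m2: "m^2 = x^2 + y^2" by (simp add: m_def)
  have PM: "P * M = \<bar>x\<bar>"
  proof -
    have "P * M = sqrt ((m + y) * (m - y))" by (simp add: P_def M_def real_sqrt_mult)
    also have "(m + y) * (m - y) = x^2" using m2 by (simp add: power2_eq_square algebra_simps)
    finally show ?thesis by simp
  qed
  have "x^2 + y^2 + y * m = m * (m + y)" "x^2 + y^2 - y * m = m * (m - y)"
    using m2 by (simp_all add: power2_eq_square algebra_simps)
  then have om: "\<omega>_plus x y = sqrt m * P" "\<omega>_minus x y = sqrt m * M"
    by (simp_all add: \<omega>_plus_def \<omega>_minus_def P_def M_def real_sqrt_mult flip: m_def)
  have root: "Re (weak_root x y) = M / sqrt 2" "Im (weak_root x y) = - (sgn x * (P / sqrt 2))"
    using assms by (simp_all add: Re_weak_root Im_weak_root P_def M_def real_sqrt_divide flip: m_def)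
  have "weak_root x y \<noteq> 0" using root pos by auto
  then have "Im (Ln (weak_root x y)) = arctan (- (sgn x * (P / M)))"
    using Re_weak_root_pos[OF assms, of y] pos by (subst Im_Ln_eq) (auto simp: root)
  also have "\<dots> = - (sgn x * arctan (P / M))"
    using assms by (simp add: sgn_if arctan_minus)
  also have "P / M = \<omega>_plus x y / \<omega>_minus x y" using m0 by (simp add: om)
  finally have angle: "weak_angle x y = - (arctan (x / y) / 2 + sgn x * arctan (\<omega>_plus x y / \<omega>_minus x y))"
    by (simp add: weak_angle_def)
  have "x^2 + y^2 = m powr 2" using m2 m0 by simp
  then have "(x^2 + y^2) powr (3/4) = m powr (3/2)"
    by (simp only: powr_powr) simp
  also have "\<dots> = m * sqrt m" using m0 powr_add[of m 1 "1/2"] by (simp add: powr_half_sqrt)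
  finally have pw: "(x^2 + y^2) powr (3/4) = m * sqrt m" .
  \<comment> \<open>Writing |x| as P M makes P a common factor, and then (y + m) + M^2 = 2
    m.\<close>
  have "(y + m) * (sqrt m * P) + \<bar>x\<bar> * (sqrt m * M) = sqrt m * P * ((y + m) + M^2)"
    unfolding PM[symmetric] by (simp add: power2_eq_square algebra_simps)
  also have "\<dots> = 2 * (m * sqrt m) * P" unfolding sq by simp
  finally have "((y + m) * \<omega>_plus x y + \<bar>x\<bar> * \<omega>_minus x y) / (sqrt 2 * (x^2 + y^2) powr (3/4) * sgn x)
      = 2 * (m * sqrt m) * P / (sqrt 2 * (m * sqrt m) * sgn x)"
    unfolding om pw by simp
  also have "\<dots> = 2 * (sgn x * (P / sqrt 2))"
    using m0 assms by (simp add: sgn_if)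
  finally have term1: "((y + m) * \<omega>_plus x y + \<bar>x\<bar> * \<omega>_minus x y) / (sqrt 2 * (x^2 + y^2) powr (3/4) * sgn x)
      = - 2 * Im (weak_root x y)" by (simp add: root)
  have "weak_field_part \<psi> x y = \<psi> * weak_angle x y +
      \<psi> * (((y + m) * \<omega>_plus x y + \<bar>x\<bar> * \<omega>_minus x y) / (sqrt 2 * (x^2 + y^2) powr (3/4) * sgn x))"
    by (simp add: weak_field_part_def angle m_def algebra_simps)
  then show ?thesis unfolding term1 by (simp add: algebra_simps)
qed

text \<open>The first three coefficients are 0, 2, 0: the function vanishes at 0, and its derivative
  2 csqrt (1 + q^2) has value 2 and slope 0 there. Splitting off three terms removes only 2
  q.\<close>

lemma weak_primitive_sums:
  assumes "cmod q < 1"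
  shows "(\<lambda>n. (deriv ^^ (n + 3)) weak_primitive 0 / fact (n + 3) * q ^ (n + 3)) sums (weak_primitive q - 2 * q)"
proof -
  define a where "a n = (deriv ^^ n) weak_primitive 0 / fact n" for n
  have der: "deriv weak_primitive q = 2 * csqrt (1 + q^2)" if "cmod q < 1" for q
    using DERIV_imp_deriv[OF weak_primitive_has_field_derivative[OF that]] .
  have "weak_primitive holomorphic_on ball 0 1"
    unfolding holomorphic_on_open[OF open_ball]
    by (intro ballI exI) (rule weak_primitive_has_field_derivative, simp)
  from holomorphic_power_series[OF this, of q] assms
  have s: "(\<lambda>n. a n * q ^ n) sums weak_primitive q" by (simp add: a_def)
  have a0: "a 0 = 0" by (simp add: a_def weak_primitive_def)
  have a1: "a 1 = 2" by (simp add: a_def der)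
  have ev: "\<forall>\<^sub>F q in nhds 0. deriv weak_primitive q = 2 * csqrt (1 + q^2)"
  proof -
    have "\<forall>\<^sub>F q in nhds (0::complex). q \<in> ball 0 1"
      by (rule eventually_nhds_in_open) auto
    then show ?thesis by eventually_elim (rule der, simp)
  qed
  have "((\<lambda>q. 2 * csqrt (1 + q^2)) has_field_derivative 0) (at 0)"
    by (auto intro!: derivative_eq_intros simp: complex_nonpos_Reals_iff)
  then have "deriv (deriv weak_primitive) 0 = 0"
    using deriv_cong_ev[OF ev refl] by (simp add: DERIV_imp_deriv)
  then have a2: "a 2 = 0" by (simp add: a_def numeral_2_eq_2)
  have "(\<Sum>n<3. a n * q ^ n) = 2 * q" using a0 a1 a2 by (simp add: numeral_3_eq_3 numeral_2_eq_2)
  then show ?thesis using sums_split_initial_segment[OF s, of 3] by (simp add: a_def)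
qed

lemma weak_primitive_bound:
  "\<exists>C. \<forall>q. cmod q \<le> 1/2 \<longrightarrow> cmod (weak_primitive q - 2 * q) \<le> C * cmod q ^ 3"
proof -
  define b where "b n = (deriv ^^ (n + 3)) weak_primitive 0 / fact (n + 3)" for n
  have s: "(\<lambda>n. b n * q ^ (n + 3)) sums (weak_primitive q - 2 * q)" if "cmod q < 1" for q
    using weak_primitive_sums[OF that] by (simp add: b_def)
  have s': "(\<lambda>n. b n * q ^ n) sums ((weak_primitive q - 2 * q) / q^3)" if "cmod q < 1" "q \<noteq> 0" for q
    using sums_divide[OF s[OF that(1)], of "q^3"] that(2) by (simp add: power_add)
  \<comment> \<open>Convergence at a point strictly between 1/2 and 1 gives absolute convergence at
    1/2, whose sum bounds the cubic quotient on the whole smaller disc.\<close>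
  have "summable (\<lambda>n. b n * (3/4) ^ n)"
    using s'[of "3/4"] by (auto simp: sums_iff)
  then have sm: "summable (\<lambda>n. cmod (b n * (1/2) ^ n))"
    by (rule powser_insidea) simp
  define C where "C = (\<Sum>n. cmod (b n * (1/2) ^ n))"
  have "cmod (weak_primitive q - 2 * q) \<le> C * cmod q ^ 3" if q: "cmod q \<le> 1/2" for q
  proof (cases "q = 0")
    case True
    then show ?thesis by (simp add: weak_primitive_def)
  next
    case False
    have le: "cmod (b n * q ^ n) \<le> cmod (b n * (1/2) ^ n)" for n
      using q by (simp add: norm_mult norm_power norm_divide power_one_over[symmetric] mult_left_mono power_mono)
    have sm': "summable (\<lambda>n. cmod (b n * q ^ n))"
      by (rule summable_comparison_test[OF _ sm]) (use le in auto)
    have "cmod ((weak_primitive q - 2 * q) / q^3) = cmod (\<Sum>n. b n * q ^ n)"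
      using s'[of q] q False by (simp add: sums_iff)
    also have "\<dots> \<le> (\<Sum>n. cmod (b n * q ^ n))" by (rule summable_norm[OF sm'])
    also have "\<dots> \<le> C" unfolding C_def by (rule suminf_le[OF le sm' sm])
    finally show ?thesis using False by (simp add: norm_divide norm_power field_simps)
  qed
  then show ?thesis by blast
qed

section \<open>The remainder beyond the linear term\<close>

definition weak_remainder :: "real \<Rightarrow> real \<Rightarrow> real" where
  "weak_remainder x y = - Im (weak_primitive (weak_root x y) - 2 * weak_root x y)"

lemma eventually_norm_small:
  assumes "e > 0"
  shows "\<forall>\<^sub>F (x, y) in at (0, 0) within off_axes. sqrt (x^2 + y^2) < e"
  using eventually_at_ball[OF assms, of "(0, 0)" off_axes]
  by eventually_elim (auto simp: dist_norm norm_Pair power2_eq_square)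

text \<open>The root scales with sqrt a, so the Taylor term of degree n + 3 scales with exponent (n
  + 3) / 2. The estimate uniform in the direction is the cubic bound, as the root has modulus sqrt
  m.\<close>

lemma terms_of_order_weak_remainder: "terms_of_order (3/2) weak_remainder"
proof -
  define b where "b n = (deriv ^^ (n + 3)) weak_primitive 0 / fact (n + 3)" for n
  define h where "h n x y = - Im (b n * weak_root x y ^ (n + 3))" for n x y
  define \<kappa> where "\<kappa> n = (real n + 3) / 2" for n
  have "strict_mono \<kappa>" by (auto simp: strict_mono_def \<kappa>_def)
  moreover have "\<forall>n. 3/2 \<le> \<kappa> n" by (simp add: \<kappa>_def)
  moreover have "h n (a * x) (a * y) = a powr \<kappa> n * h n x y" if "a > 0" for n a x y
  proof -
    have "sqrt a ^ (n + 3) = sqrt a powr real (n + 3)"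
      using that by (intro powr_realpow[symmetric]) simp
    also have "\<dots> = a powr \<kappa> n"
      using that by (simp add: powr_half_sqrt[symmetric] powr_powr \<kappa>_def add_divide_distrib)
    finally have pw: "sqrt a ^ (n + 3) = a powr \<kappa> n" .
    have "b n * weak_root (a * x) (a * y) ^ (n + 3) = of_real (sqrt a ^ (n + 3)) * (b n * weak_root x y ^ (n + 3))"
      unfolding weak_root_scale[OF that] by (simp only: power_mult_distrib of_real_power mult_ac)
    moreover have "Im (of_real c * Z) = c * Im Z" for c Z by simp
    ultimately show ?thesis by (simp only: h_def pw mult_minus_right)
  qed
  moreover have "\<forall>\<^sub>F (x, y) in at (0, 0) within off_axes. (\<lambda>n. h n x y) sums weak_remainder x y"
    using eventually_norm_small[OF zero_less_one]
  proof eventually_elim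
    case (elim z)
    obtain x y where z: "z = (x, y)" by (cases z)
    have "cmod (weak_root x y) < 1" using elim by (simp add: z norm_weak_root)
    from sums_minus[OF sums_Im[OF weak_primitive_sums[OF this]]] show ?case
      by (simp add: z h_def b_def weak_remainder_def)
  qed
  moreover have "(\<lambda>(x, y). weak_remainder x y)
      \<in> O[at (0, 0) within off_axes](\<lambda>(x, y). sqrt (x^2 + y^2) powr (3/2))"
  proof -
    obtain C where C: "\<And>q. cmod q \<le> 1/2 \<Longrightarrow> cmod (weak_primitive q - 2 * q) \<le> C * cmod q ^ 3"
      using weak_primitive_bound by blast
    \<comment> \<open>For m < 1/4 the modulus sqrt m of the root is at most 1/2, the range of the
      cubic bound.\<close>
    have quarter: "(0::real) < 1/4" by simp
    have "\<forall>\<^sub>F z in at (0, 0) within off_axes. norm (case z of (x, y) \<Rightarrow> weak_remainder x y)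
        \<le> C * norm (case z of (x, y) \<Rightarrow> sqrt (x^2 + y^2) powr (3/2))"
      using eventually_norm_small[OF quarter]
    proof eventually_elim
      case (elim z)
      obtain x y where z: "z = (x, y)" by (cases z)
      define m where "m = sqrt (x^2 + y^2)"
      have m: "0 \<le> m" "m < 1/4" using elim by (simp_all add: z m_def)
      have nq: "cmod (weak_root x y) = sqrt m" by (simp add: norm_weak_root m_def)
      have "sqrt m \<le> 1/2" using m real_sqrt_le_mono[of m "1/4"] by (simp add: real_sqrt_divide)
      then have "\<bar>weak_remainder x y\<bar> \<le> C * sqrt m ^ 3"
        using C[of "weak_root x y"] abs_Im_le_cmod[of "weak_primitive (weak_root x y) - 2 * weak_root x y"]
        by (simp add: weak_remainder_def nq)
      also have "sqrt m ^ 3 = m powr (3/2)"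
      proof (cases "m = 0")
        case False
        have "sqrt m ^ 3 = sqrt m powr real 3"
          using m False by (intro powr_realpow[symmetric]) simp
        also have "\<dots> = m powr (3/2)"
          using m by (simp add: powr_half_sqrt[symmetric] powr_powr)
        finally show ?thesis .
      qed simp
      finally show ?case by (simp add: z m_def)
    qed
    then show ?thesis by (rule bigoI)
  qed
  ultimately show ?thesis unfolding terms_of_order_def by blast
qed

lemma L_psiM_weak_expansion:
  assumes "s \<noteq> 0" "\<psi> \<noteq> 0"
  shows "L_psiM s p \<psi> = weak_field_part \<psi> (s / \<psi>) (p / \<psi>) + \<psi> * weak_remainder (s / \<psi>) (p / \<psi>)"
proof -
  have "s / \<psi> \<noteq> 0" using assms by simp
  then show ?thesis
    unfolding L_psiM_scale[OF assms] L_psiM_weak_form[OF \<open>s / \<psi> \<noteq> 0\<close>] weak_field_part_eq[OF \<open>s / \<psi> \<noteq> 0\<close>]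
    by (simp add: weak_remainder_def algebra_simps)
qed

section \<open>Behaviour along rays and for large \<psi>\<close>

lemma L_psiM_along_ray:
  assumes "a > 0" "s \<noteq> 0"
  shows "L_psiM (a * s) (a * p) 1 =
    weak_angle s p - Im (weak_primitive (of_real (sqrt a) * weak_root s p))"
  using assms L_psiM_weak_form[of "a * s" "a * p"]
  by (simp add: weak_angle_scale weak_root_scale)

lemma weak_primitive_tendsto_0:
  "((\<lambda>a. weak_primitive (of_real (sqrt a) * q)) \<longlongrightarrow> 0) (at_right 0)"
proof -
  have "isCont weak_primitive 0"
    using weak_primitive_has_field_derivative[of 0] by (intro DERIV_isCont) auto
  moreover have "((\<lambda>a. complex_of_real (sqrt a) * q) \<longlongrightarrow> of_real (sqrt 0) * q) (at_right 0)"
    by (intro tendsto_intros)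
  ultimately show ?thesis
    using isCont_tendsto_compose[of 0 weak_primitive] by (simp add: weak_primitive_def[of 0])
qed

lemma weak_primitive_quotient_tendsto:
  assumes "q \<noteq> 0"
  shows "((\<lambda>a. weak_primitive (of_real (sqrt a) * q) / of_real (sqrt a)) \<longlongrightarrow> 2 * q) (at_right 0)"
proof -
  have "((\<lambda>h. weak_primitive h / h) \<longlongrightarrow> 2) (at 0)"
    using weak_primitive_has_field_derivative[of 0] by (simp add: DERIV_def weak_primitive_def[of 0])
  moreover have "filterlim (\<lambda>a. complex_of_real (sqrt a) * q) (at 0) (at_right 0)"
  proof -
    have "((\<lambda>a. complex_of_real (sqrt a) * q) \<longlongrightarrow> of_real (sqrt 0) * q) (at_right 0)"
      by (intro tendsto_intros)
    moreover have "\<forall>\<^sub>F a in at_right (0::real). complex_of_real (sqrt a) * q \<noteq> 0"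
      using eventually_at_right_less by eventually_elim (use assms in simp)
    ultimately show ?thesis by (simp add: filterlim_at)
  qed
  ultimately have "((\<lambda>a. weak_primitive (of_real (sqrt a) * q) / (of_real (sqrt a) * q)) \<longlongrightarrow> 2) (at_right 0)"
    by (rule filterlim_compose)
  from tendsto_mult_right[OF this, of q] show ?thesis using assms by simp
qed

lemma L_psiM_along_ray_tendsto:
  assumes "s \<noteq> 0"
  shows "((\<lambda>a. L_psiM (a * s) (a * p) 1) \<longlongrightarrow> weak_angle s p) (at_right 0)"
proof -
  have "((\<lambda>a. weak_angle s p - Im (weak_primitive (of_real (sqrt a) * weak_root s p)))
      \<longlongrightarrow> weak_angle s p - Im 0) (at_right 0)"
    by (intro tendsto_intros weak_primitive_tendsto_0)
  moreover have "\<forall>\<^sub>F a in at_right 0.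
      weak_angle s p - Im (weak_primitive (of_real (sqrt a) * weak_root s p)) = L_psiM (a * s) (a * p) 1"
    using eventually_at_right_less by eventually_elim (simp add: L_psiM_along_ray assms)
  ultimately show ?thesis using Lim_transform_eventually by fastforce
qed

text \<open>Beyond the angle the next term is - Im (2 q), of exact order sqrt a because Im q is
  nonzero for s \<noteq> 0. It rules out a finite limit for large \<psi> when the angle happens to
  vanish.\<close>

lemma L_psiM_along_ray_deviation_tendsto:
  assumes "s \<noteq> 0"
  shows "((\<lambda>a. (L_psiM (a * s) (a * p) 1 - weak_angle s p) / sqrt a)
    \<longlongrightarrow> - 2 * Im (weak_root s p)) (at_right 0)"
proof -
  have "weak_root s p \<noteq> 0" using Im_weak_root_nonzero[OF assms, of p] by auto
  from tendsto_minus[OF tendsto_Im[OF weak_primitive_quotient_tendsto[OF this]]]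
  have "((\<lambda>a. - Im (weak_primitive (of_real (sqrt a) * weak_root s p) / of_real (sqrt a)))
      \<longlongrightarrow> - 2 * Im (weak_root s p)) (at_right 0)" by simp
  moreover have "\<forall>\<^sub>F a in at_right 0. - Im (weak_primitive (of_real (sqrt a) * weak_root s p) / of_real (sqrt a))
      = (L_psiM (a * s) (a * p) 1 - weak_angle s p) / sqrt a"
    using eventually_at_right_less by eventually_elim (simp add: L_psiM_along_ray assms)
  ultimately show ?thesis by (rule Lim_transform_eventually)
qed

text \<open>
  A limit would force both leading coefficients to vanish, but that of \<open>sqrt \<psi>\<close> is a nonzero
  multiple of the imaginary part of the square root.
\<close>

lemma not_L_psiM_tendsto_at_top:
  assumes "s \<noteq> 0"
  shows "\<not> ((\<lambda>\<psi>. L_psiM s p \<psi>) \<longlongrightarrow> c) at_top"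
proof
  assume lim: "((\<lambda>\<psi>. L_psiM s p \<psi>) \<longlongrightarrow> c) at_top"
  \<comment> \<open>Setting \<psi> = 1/a turns large \<psi> into the approach to the origin along a
    ray, with an extra factor 1/a.\<close>
  have "((\<lambda>a. L_psiM s p (inverse a)) \<longlongrightarrow> c) (at_right 0)"
    by (rule filterlim_compose[OF lim filterlim_inverse_at_top_right])
  moreover have "\<forall>\<^sub>F a in at_right 0. L_psiM s p (inverse a) = L_psiM (a * s) (a * p) 1 / a"
    using eventually_at_right_less
    by eventually_elim (subst L_psiM_scale, use assms in \<open>simp_all add: field_simps\<close>)
  ultimately have lim': "((\<lambda>a. L_psiM (a * s) (a * p) 1 / a) \<longlongrightarrow> c) (at_right 0)"
    by (rule Lim_transform_eventually)
  have id: "((\<lambda>a::real. a) \<longlongrightarrow> 0) (at_right 0)" by (rule tendsto_ident_at)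
  have "((\<lambda>a. a * (L_psiM (a * s) (a * p) 1 / a)) \<longlongrightarrow> 0 * c) (at_right 0)"
    by (intro tendsto_mult id lim')
  moreover have "\<forall>\<^sub>F a in at_right 0. a * (L_psiM (a * s) (a * p) 1 / a) = L_psiM (a * s) (a * p) 1"
    using eventually_at_right_less by eventually_elim simp
  ultimately have "((\<lambda>a. L_psiM (a * s) (a * p) 1) \<longlongrightarrow> 0 * c) (at_right 0)"
    by (rule Lim_transform_eventually)
  from tendsto_unique[OF _ this L_psiM_along_ray_tendsto[OF assms]]
  have angle: "weak_angle s p = 0" by simp
  \<comment> \<open>With the angle gone, multiplying by sqrt a instead of a isolates the coefficient
    of order sqrt a and forces it to be 0.\<close>
  have "((\<lambda>a. sqrt a * (L_psiM (a * s) (a * p) 1 / a)) \<longlongrightarrow> sqrt 0 * c) (at_right 0)"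
    by (intro tendsto_mult tendsto_real_sqrt id lim')
  moreover have "\<forall>\<^sub>F a in at_right 0. sqrt a * (L_psiM (a * s) (a * p) 1 / a)
      = (L_psiM (a * s) (a * p) 1 - weak_angle s p) / sqrt a"
    using eventually_at_right_less
  proof eventually_elim
    case (elim a)
    have "sqrt a * (L_psiM (a * s) (a * p) 1 / a) = L_psiM (a * s) (a * p) 1 * (sqrt a / a)" by simp
    also have "sqrt a / a = inverse (sqrt a)" using elim by (intro sqrt_divide_self_eq) simp
    finally show ?case by (simp add: angle divide_inverse)
  qed
  ultimately have "((\<lambda>a. (L_psiM (a * s) (a * p) 1 - weak_angle s p) / sqrt a) \<longlongrightarrow> sqrt 0 * c) (at_right 0)"
    by (rule Lim_transform_eventually)
  from tendsto_unique[OF _ this L_psiM_along_ray_deviation_tendsto[OF assms]]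
  show False using Im_weak_root_nonzero[OF assms, of p] by simp
qed

text \<open>Degree-one scaling also covers the factor -1, so reversing the signs of s, p and \<psi>
  together negates the Lagrangian and carries the claim over to \<open>at_top\<close>.\<close>

lemma not_L_psiM_tendsto_at_bot:
  assumes "s \<noteq> 0"
  shows "\<not> ((\<lambda>\<psi>. L_psiM s p \<psi>) \<longlongrightarrow> c) at_bot"
proof
  assume "((\<lambda>\<psi>. L_psiM s p \<psi>) \<longlongrightarrow> c) at_bot"
  then have "((\<lambda>\<psi>. - L_psiM s p (- \<psi>)) \<longlongrightarrow> - c) at_top"
    by (intro tendsto_minus) (simp add: filterlim_at_bot_mirror)
  moreover have "\<forall>\<^sub>F \<psi> in at_top. - L_psiM s p (- \<psi>) = L_psiM (- s) (- p) \<psi>"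
    using eventually_gt_at_top[of 0]
    by eventually_elim (subst (1 2) L_psiM_scale, use assms in simp_all)
  ultimately have "((\<lambda>\<psi>. L_psiM (- s) (- p) \<psi>) \<longlongrightarrow> - c) at_top"
    by (rule Lim_transform_eventually)
  then show False using not_L_psiM_tendsto_at_top[of "- s" "- p" "- c"] assms by simp
qed

section \<open>Failure of analyticity\<close>

text \<open>Unconditional convergence at one corner of a smaller square is absolute, and its terms
  dominate the series on the whole square. The Weierstrass test then makes the sum a uniform limit
  of polynomials.\<close>

lemma real_analytic_at_imp_isCont:
  assumes "real_analytic_at f a b"
  shows "isCont (\<lambda>(x, y). f x y) (a, b)"
proof -
  obtain c r where r: "r > 0" and
    sum: "\<And>x y. \<bar>x - a\<bar> < r \<Longrightarrow> \<bar>y - b\<bar> < r \<Longrightarrow>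
      ((\<lambda>(i, j). c i j * (x - a)^i * (y - b)^j) has_sum f x y) UNIV"
    using assms unfolding real_analytic_at_def by blast
  define \<rho> where "\<rho> = r / 2"
  have \<rho>: "0 < \<rho>" "\<rho> < r" using r by (simp_all add: \<rho>_def)
  define Y where "Y = {a - \<rho>..a + \<rho>} \<times> {b - \<rho>..b + \<rho>}"
  define g where "g ij z = (case ij of (i, j) \<Rightarrow> c i j * (fst z - a)^i * (snd z - b)^j)" for ij z
  define M where "M ij = (case ij of (i, j) \<Rightarrow> \<bar>c i j\<bar> * \<rho>^i * \<rho>^j)" for ij
  have Y: "\<bar>fst z - a\<bar> \<le> \<rho>" "\<bar>snd z - b\<bar> \<le> \<rho>" if "z \<in> Y" for z
    using that by (auto simp: Y_def abs_le_iff)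
  have "(\<lambda>(i, j). c i j * \<rho>^i * \<rho>^j) summable_on UNIV"
    using sum[of "a + \<rho>" "b + \<rho>"] \<rho> by (auto dest: has_sum_imp_summable)
  then have "(\<lambda>ij. norm (case ij of (i, j) \<Rightarrow> c i j * \<rho>^i * \<rho>^j)) summable_on UNIV"
    by (rule iffD1[OF summable_on_iff_abs_summable_on_real])
  moreover have "(\<lambda>ij. norm (case ij of (i, j) \<Rightarrow> c i j * \<rho>^i * \<rho>^j)) = M"
    using \<rho> by (auto simp: M_def fun_eq_iff abs_mult)
  ultimately have summ: "M summable_on UNIV" by simp
  have "uniform_limit Y (\<lambda>X z. \<Sum>ij\<in>X. g ij z) (\<lambda>z. f (fst z) (snd z)) (finite_subsets_at_top UNIV)"
  proof (rule Weierstrass_m_test_general'[OF _ _ summ])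
    fix ij z assume z: "z \<in> Y"
    show "norm (g ij z) \<le> M ij"
      using Y[OF z] by (auto simp: g_def M_def abs_mult power_abs split: prod.split
          intro!: mult_mono power_mono)
  next
    fix z assume z: "z \<in> Y"
    have "((\<lambda>(i, j). c i j * (fst z - a)^i * (snd z - b)^j) has_sum f (fst z) (snd z)) UNIV"
      by (rule sum) (use Y[OF z] \<rho> in auto)
    then show "((\<lambda>ij. g ij z) has_sum f (fst z) (snd z)) UNIV" by (simp add: g_def)
  qed
  moreover have "continuous_on Y (\<lambda>z. \<Sum>ij\<in>X. g ij z)" for X
    unfolding g_def by (intro continuous_on_sum) (auto split: prod.split intro!: continuous_intros)
  ultimately have "continuous_on Y (\<lambda>z. f (fst z) (snd z))"
    by (intro uniform_limit_theorem[where F = "finite_subsets_at_top UNIV"]) auto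
  moreover have "(a, b) \<in> interior Y"
    using \<rho> by (simp add: Y_def interior_Times)
  ultimately show ?thesis
    using continuous_on_interior by (fastforce simp: case_prod_beta')
qed

text \<open>The value - pi/8 separates the two: on one diagonal pi/8 is subtracted from a negative
  argument, on the other it is added to an argument above - pi/4.\<close>

lemma weak_angle_diagonals: "weak_angle 1 1 < weak_angle 1 (- 1)"
proof -
  have arg: "Im (Ln (weak_root 1 y)) = arctan (Im (weak_root 1 y) / Re (weak_root 1 y))" for y
    using Re_weak_root_pos[of 1 y] by (subst Im_Ln_eq) auto
  have "Im (weak_root 1 1) < 0" by (simp add: Im_weak_root add_pos_pos)
  then have "Im (weak_root 1 1) / Re (weak_root 1 1) < 0"
    using Re_weak_root_pos[of 1 1] by (simp add: divide_neg_pos)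
  then have 1: "Im (Ln (weak_root 1 1)) < 0" unfolding arg by simp
  have "Re (weak_root 1 (- 1)) = sqrt ((sqrt 2 + 1) / 2)" "Im (weak_root 1 (- 1)) = - sqrt ((sqrt 2 - 1) / 2)"
    by (simp_all add: Re_weak_root Im_weak_root)
  moreover have "sqrt ((sqrt 2 - 1) / 2) < sqrt ((sqrt 2 + 1) / 2)" by simp
  ultimately have "- 1 < Im (weak_root 1 (- 1)) / Re (weak_root 1 (- 1))"
    using Re_weak_root_pos[of 1 "- 1"] by (simp add: pos_less_divide_eq)
  then have "arctan (- 1) < Im (Ln (weak_root 1 (- 1)))" unfolding arg by (simp only: arctan_less_iff)
  then have "- (pi / 4) < Im (Ln (weak_root 1 (- 1)))" by (simp add: arctan_minus)
  with 1 show ?thesis by (simp add: weak_angle_def arctan_minus)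
qed

text \<open>Continuity of f would make the limit along every ray equal to \<open>f 0 0\<close>,
  whereas the limit of the Lagrangian is \<psi> times the angle and differs between the
  diagonals.\<close>

lemma L_psiM_not_real_analytic_at_null:
  assumes "\<psi> \<noteq> 0" and f: "real_analytic_at f 0 0"
    and eq: "\<forall>\<^sub>F (s, p) in at (0, 0) within off_axes. f s p = L_psiM s p \<psi>"
  shows False
proof -
  have angle: "f 0 0 = \<psi> * weak_angle 1 e" if "e \<noteq> 0" for e
  proof -
    \<comment> \<open>The factor \<psi> in the curve makes the rescaled point (t, t e), which has
      positive first coordinate for either sign of \<psi>.\<close>
    define v where "v t = (t * \<psi>, t * \<psi> * e)" for t
    have v: "(v \<longlongrightarrow> (0, 0)) (at_right 0)" unfolding v_def by (auto intro!: tendsto_eq_intros)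
    have "filterlim v (at (0, 0) within off_axes) (at_right 0)"
      unfolding filterlim_at
    proof
      show "\<forall>\<^sub>F t in at_right 0. v t \<in> off_axes \<and> v t \<noteq> (0, 0)"
        using eventually_at_right_less
        by eventually_elim (use assms(1) that in \<open>auto simp: v_def off_axes_def\<close>)
    qed (rule v)
    from eventually_compose_filterlim[OF eq this]
    have "\<forall>\<^sub>F t in at_right 0. f (t * \<psi>) (t * \<psi> * e) = L_psiM (t * \<psi>) (t * \<psi> * e) \<psi>"
      by (simp add: v_def)
    then have ev: "\<forall>\<^sub>F t in at_right 0. (case v t of (x, y) \<Rightarrow> f x y) = \<psi> * L_psiM (t * 1) (t * e) 1"
      using eventually_at_right_less
      by eventually_elim (subst (asm) L_psiM_scale, use assms(1) in \<open>simp_all add: v_def\<close>)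
    have "((\<lambda>t. case v t of (x, y) \<Rightarrow> f x y) \<longlongrightarrow> f 0 0) (at_right 0)"
      using isCont_tendsto_compose[OF real_analytic_at_imp_isCont[OF f] v] by simp
    from Lim_transform_eventually[OF this ev]
    have "((\<lambda>t. \<psi> * L_psiM (t * 1) (t * e) 1) \<longlongrightarrow> f 0 0) (at_right 0)" .
    moreover have "((\<lambda>t. \<psi> * L_psiM (t * 1) (t * e) 1) \<longlongrightarrow> \<psi> * weak_angle 1 e) (at_right 0)"
      by (intro tendsto_mult tendsto_const L_psiM_along_ray_tendsto) simp
    ultimately show ?thesis by (rule tendsto_unique[rotated]) simp
  qed
  from angle[of 1] angle[of "- 1"] weak_angle_diagonals assms(1) show False by simp
qed

theorem mainTheorem4:
  shows
   "((\<forall>s p \<psi>. s \<noteq> 0 \<and> p \<noteq> 0 \<and> \<psi> \<noteq> 0 \<longrightarrow>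
        duality_invariant_at L_psiM s p \<psi> \<and>
        ((\<lambda>s'. L_psiM s' p \<psi>) has_real_derivative t_plus s p \<psi> / sqrt 2) (at s) \<and>
        ((\<lambda>p'. L_psiM s p' \<psi>) has_real_derivative t_minus s p \<psi> / sqrt 2) (at p) \<and>
        ((\<lambda>\<psi>'. L_psiM s p \<psi>') has_real_derivative - (t_psi s p \<psi> / 2)) (at \<psi>)) \<and>
     (\<forall>s p \<psi>. s \<noteq> 0 \<and> \<psi> \<noteq> 0 \<longrightarrow>
        (t_plus s p \<psi>)^2 = (t_minus s p \<psi>)^2 + 2 - 2 * \<psi> * p / (s^2 + p^2) \<and>
        t_plus s p \<psi> * t_minus s p \<psi> = \<psi> * s / (s^2 + p^2)))
    \<and>
    (\<forall>s p \<psi>. s \<noteq> 0 \<and> p \<noteq> 0 \<and> \<psi> \<noteq> 0 \<longrightarrow> homogeneity_condition_at L_psiM s p \<psi>)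
    \<and>
    (\<forall>s p. ((\<lambda>\<psi>. L_psiM s p \<psi>) \<longlongrightarrow> s) (at 0))
    \<and>
    ((\<forall>s p \<psi> :: real. s^2 + p^2 \<noteq> 0 \<longrightarrow>
        (s^2 + (\<psi> - p)^2) / (s^2 + p^2) =
          \<psi>^2 * s^2 / (s^2 + p^2)^2 + (1 - \<psi> * p / (s^2 + p^2))^2) \<and>
     (\<forall>s p \<psi> :: real.
        L_psiM_complex (of_real s) (of_real p) (of_real \<psi>) \<in> \<real> \<and>
        L_psiM_complex (of_real s) (of_real p) (of_real \<psi>) = of_real (L_psiM s p \<psi>)))
    \<and>
    (\<forall>\<psi>. \<psi> \<noteq> 0 \<longrightarrow>
       \<not> (\<exists>f. real_analytic_at f 0 0 \<and>
              (\<forall>\<^sub>F (s, p) in at (0, 0) within off_axes. f s p = L_psiM s p \<psi>)))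
    \<and>
    ((\<exists>R. terms_of_order (3/2) R \<and>
        (\<forall>s p \<psi>. s \<noteq> 0 \<and> p \<noteq> 0 \<and> \<psi> \<noteq> 0 \<longrightarrow>
           L_psiM s p \<psi> = weak_field_part \<psi> (s / \<psi>) (p / \<psi>) + \<psi> * R (s / \<psi>) (p / \<psi>))) \<and>
     (\<forall>s p. s \<noteq> 0 \<and> p \<noteq> 0 \<longrightarrow>
        \<not> ((\<lambda>\<psi>. L_psiM s p \<psi>) \<longlongrightarrow> s) at_top \<and>
        \<not> ((\<lambda>\<psi>. L_psiM s p \<psi>) \<longlongrightarrow> s) at_bot))
    \<and>
    ((\<forall>\<gamma> s p \<psi>. ModMax_map \<gamma> L_psiM s p \<psi> = L_psiM (L_MM \<gamma> s p) p \<psi>) \<and>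
     inj (\<lambda>\<gamma>. ModMax_map \<gamma> L_psiM) \<and>
     (\<forall>\<gamma> s p \<psi>. L_MM \<gamma> s p \<noteq> 0 \<and> p \<noteq> 0 \<and> \<psi> \<noteq> 0 \<longrightarrow>
        duality_invariant_at (ModMax_map \<gamma> L_psiM) s p \<psi>) \<and>
     (\<forall>\<gamma> s p. ((\<lambda>\<psi>. ModMax_map \<gamma> L_psiM s p \<psi>) \<longlongrightarrow> L_MM \<gamma> s p) (at 0)))"
proof (intro conjI)
  show "\<forall>s p \<psi>. s \<noteq> 0 \<and> p \<noteq> 0 \<and> \<psi> \<noteq> 0 \<longrightarrow>
        duality_invariant_at L_psiM s p \<psi> \<and>
        ((\<lambda>s'. L_psiM s' p \<psi>) has_real_derivative t_plus s p \<psi> / sqrt 2) (at s) \<and>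
        ((\<lambda>p'. L_psiM s p' \<psi>) has_real_derivative t_minus s p \<psi> / sqrt 2) (at p) \<and>
        ((\<lambda>\<psi>'. L_psiM s p \<psi>') has_real_derivative - (t_psi s p \<psi> / 2)) (at \<psi>)"
    by (intro allI impI conjI duality_invariant_L_psiM L_psiM_partial_derivatives) simp_all
  show "\<forall>s p \<psi>. s \<noteq> 0 \<and> \<psi> \<noteq> 0 \<longrightarrow>
        (t_plus s p \<psi>)^2 = (t_minus s p \<psi>)^2 + 2 - 2 * \<psi> * p / (s^2 + p^2) \<and>
        t_plus s p \<psi> * t_minus s p \<psi> = \<psi> * s / (s^2 + p^2)"
    by (intro allI impI conjI t_identities) simp_all
  show "\<exists>R. terms_of_order (3/2) R \<and>
        (\<forall>s p \<psi>. s \<noteq> 0 \<and> p \<noteq> 0 \<and> \<psi> \<noteq> 0 \<longrightarrow>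
           L_psiM s p \<psi> = weak_field_part \<psi> (s / \<psi>) (p / \<psi>) + \<psi> * R (s / \<psi>) (p / \<psi>))"
    by (intro exI[of _ weak_remainder] conjI allI impI terms_of_order_weak_remainder
        L_psiM_weak_expansion) simp_all
  show "\<forall>\<psi>. \<psi> \<noteq> 0 \<longrightarrow>
       \<not> (\<exists>f. real_analytic_at f 0 0 \<and>
              (\<forall>\<^sub>F (s, p) in at (0, 0) within off_axes. f s p = L_psiM s p \<psi>))"
    by (intro allI impI notI, elim exE conjE) (rule L_psiM_not_real_analytic_at_null)
  show "\<forall>s p \<psi> :: real. s^2 + p^2 \<noteq> 0 \<longrightarrow>
        (s^2 + (\<psi> - p)^2) / (s^2 + p^2) =
          \<psi>^2 * s^2 / (s^2 + p^2)^2 + (1 - \<psi> * p / (s^2 + p^2))^2"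
    by (intro allI impI discriminant_identity)
  show "\<forall>s p \<psi> :: real.
        L_psiM_complex (of_real s) (of_real p) (of_real \<psi>) \<in> \<real> \<and>
        L_psiM_complex (of_real s) (of_real p) (of_real \<psi>) = of_real (L_psiM s p \<psi>)"
    by (simp add: L_psiM_complex_of_real)
  show "\<forall>\<gamma> s p \<psi>. ModMax_map \<gamma> L_psiM s p \<psi> = L_psiM (L_MM \<gamma> s p) p \<psi>"
    by (simp add: ModMax_map_def)
  show "\<forall>s p \<psi>. s \<noteq> 0 \<and> p \<noteq> 0 \<and> \<psi> \<noteq> 0 \<longrightarrow> homogeneity_condition_at L_psiM s p \<psi>"
    by (simp add: homogeneity_L_psiM)
  show "\<forall>s p. ((\<lambda>\<psi>. L_psiM s p \<psi>) \<longlongrightarrow> s) (at 0)"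
    by (simp add: L_psiM_tendsto_Maxwell)
  show "\<forall>s p. s \<noteq> 0 \<and> p \<noteq> 0 \<longrightarrow>
        \<not> ((\<lambda>\<psi>. L_psiM s p \<psi>) \<longlongrightarrow> s) at_top \<and>
        \<not> ((\<lambda>\<psi>. L_psiM s p \<psi>) \<longlongrightarrow> s) at_bot"
    by (simp add: not_L_psiM_tendsto_at_top not_L_psiM_tendsto_at_bot)
  show "inj (\<lambda>\<gamma>. ModMax_map \<gamma> L_psiM)"
    by (rule inj_ModMax_map)
  show "\<forall>\<gamma> s p \<psi>. L_MM \<gamma> s p \<noteq> 0 \<and> p \<noteq> 0 \<and> \<psi> \<noteq> 0 \<longrightarrow>
        duality_invariant_at (ModMax_map \<gamma> L_psiM) s p \<psi>"
    by (simp add: duality_invariant_ModMax_map)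
  show "\<forall>\<gamma> s p. ((\<lambda>\<psi>. ModMax_map \<gamma> L_psiM s p \<psi>) \<longlongrightarrow> L_MM \<gamma> s p) (at 0)"
    by (simp add: ModMax_map_tendsto)
qed

end
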